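(* Let $m,r,n\in\mathbb N$ with $m+r=n$ and put $k=n-1$. Let $\lambda,\mu,\nu\subseteq R_r=(r^m)$ be partitions and $d\in\mathbb Z_{\ge 0}$ with $|\lambda|+|\mu|=|\nu|+nd$. Then the diagram $\mathrm{QH}^*(\mathrm{Gr}_{m,n})\xrightarrow{\Gamma_{\mathrm{SD}}}\mathrm{QH}^*(\mathrm{Gr}_{m,n})\xrightarrow{\Psi_{\mathrm{PC}}}\mathrm{QH}^*(\mathrm{Fl}_n)\xrightarrow{\Gamma_{\mathrm T}}\mathrm{QH}^*(\mathrm{Fl}_n)$ versus $\mathrm{QH}^*(\mathrm{Gr}_{m,n})\xrightarrow{\Phi_{\mathrm{Gr}}}\mathrm H_*(\mathcal Gr_n)\xrightarrow{\Phi_{\mathrm{Fl}}}\mathrm{QH}^*(\mathrm{Fl}_n)$ on Littlewood–Richardson coefficients commutes, i.e. $$\Gamma_{\mathrm T}\circ\Psi_{\mathrm{PC}}\circ\Gamma_{\mathrm{SD}}\big(c_{\lambda,\mu}^{\nu,d}\big)=\Phi_{\mathrm{Fl}}\circ\Phi_{\mathrm{Gr}}\big(c_{\lambda,\mu}^{\nu,d}\big).$$ Explicitly: with $t=\mathrm{diag}_0(\nu^\vee)-d$ and $s=\mathrm{diag}_0((\nu\oplus d)^{\vee_r})$, the quantum Littlewood–Richardson coefficient of $\mathrm{QH}^*(\mathrm{Fl}_n)$ $$c_{\,w_0w_{\lambda^\vee}w_0,\;w_0w_{\mu^\vee}w_0}^{\,w_0\,w_{\phi^r(\nu)^\vee}\,w_0^P\,w_0^{P'_t}\,w_0,\;(0^{r-t},1,2,\dots,t-1,t,t-1,\dots,1,0^{m-t})}$$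 is the same coefficient (same indexing permutations and same degree vector) as $$c_{\,\varphi_r(\lambda),\;\varphi_r(\mu)}^{\,\varphi_{r-s}(\eta^2)\varphi_{r+s}(\eta^1),\;(0^{r-s},1,2,\dots,s-1,s,s-1,\dots,1,0^{m-s})}.$$
   Context: Partitions are drawn as Ferrers shapes in French notation (row 1 lowest). For $1\le i\le k$, $R_i=(i^{n-i})$ is the rectangle with $i$ columns and $n-i$ rows; in particular $R_r=(r^m)$. For $\lambda=(\lambda_1,\dots,\lambda_{n-j})\subseteq R_j$ its complement is $\lambda^{\vee_j}=(j-\lambda_{n-j},\dots,j-\lambda_1)$; $\lambda^\vee$ means $\lambda^{\vee_r}$ for $\lambda\subseteq R_r$. $\lambda'$ is the transpose partition. $\mathrm{diag}_0(\lambda)$ is the number of cells of $\lambda$ with equal row and column index. The bit string $b_\lambda\in\{0,1\}^n$ of $\lambda\subseteq R_r$ is obtained by tracing the boundary of $\lambda$ from the upper left corner of $R_r$ to its lower right corner, recording a vertical step as 0 and a horizontal step as 1; $\phi^a$ maps $\lambda$ to the partition whose bit string is obtained by moving the first $a$ bits of $b_\lambda$ to the end. Permutations in $S_n$ are written in one-line notation $w=[w(1)\cdots w(n)]$; $w_0=[n\,\cdots\,1]$; for $w\in S_n$, $w'=w_0ww_0$. For a partition $\lambda$ with $j$ parts (padded with zeros) contained in $R_{n-j}$, $w_\lambda\in S_n$ is defined by $w_\lambda(i)=\lambda_{j-i+1}+i$ for $1\le i\le j$, with $w_\lambda(j+1)<\dots<w_\lambda(n)$ the remaining values; for $\eta\subseteq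 R_j$, $\varphi_j(\eta)=w_{(\eta^{\vee_j})'}$ (the transpose $(\eta^{\vee_j})'$ has $j$ rows). $w_0^P=[m\cdots 1\mid n\cdots m+1]$, and for $0\le e\le\min\{m,r\}$, $w_0^{P'_e}=[m-e\cdots1\mid m\cdots m-e+1\mid m+e\cdots m+1\mid n\cdots m+e+1]$ (each block listed in decreasing order). An $n$-rim hook is a connected skew shape with $n$ cells containing no $2\times2$ square; its head is its southeasternmost cell. $\nu\oplus d$ is the partition obtained from $\nu$ by adding $d$ $n$-rim hooks so that all $d$ heads lie in column $r$. $(\nu\oplus d)^{\vee_r}$ denotes the complement in $R_r$ of the part of $\nu\oplus d$ lying inside $R_r$. With $s=\mathrm{diag}_0((\nu\oplus d)^{\vee_r})$, write $\nu\oplus d=(\eta^1,\eta^2)$ where $\eta^1$ consists of the bottom $m-s$ rows of $\nu\oplus d$ and $\eta^2$ of the remaining rows. Quantum Littlewood–Richardson coefficients: in $\mathrm{QH}^*(\mathrm{Gr}_{m,n})$, $\sigma_\lambda*\sigma_\mu=\sum_{\nu\subseteq R_r,d}c_{\lambda,\mu}^{\nu,d}q^d\sigma_\nu$; in $\mathrm{QH}^*(\mathrm{Fl}_n)$, $\sigma_u*\sigma_v=\sum_{w,\mathbf d}c_{u,v}^{w,\mathbf d}\mathbf q^{\mathbf d}\sigma_w$ with $\mathbf d\in\mathbb Z_{\ge0}^k$; the $k$-Littlewood–Richardson coefficients $C_{\lambda,\mu}^{\eta,(k)}$ are defined by $s^{(k)}_\lambda s^{(k)}_\mu=\sum_\eta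 C^{\eta,(k)}_{\lambda,\mu}s^{(k)}_\eta$ for $k$-Schur functions indexed by $k$-bounded partitions. The correspondences act on indices as follows: $\Gamma_{\mathrm{SD}}(c_{\lambda,\mu}^{\nu,d})=c_{\lambda^\vee,\mu^\vee}^{\phi^r(\nu)^\vee,\,\mathrm{diag}_0(\nu^\vee)-d}$; for $u,v,w\in S_n$ Grassmannian with descent only possibly at $m$ and $0\le e\le\min\{m,r\}$, $\Psi_{\mathrm{PC}}(c^{\lambda_w,e}_{\lambda_u,\lambda_v})=c_{u,v}^{ww_0^Pw_0^{P'_e},\,(0^{m-e},1,\dots,e-1,e,e-1,\dots,1,0^{r-e})}$ where $\lambda_w=(w(m)-m,\dots,w(1)-1)$ (inverse to $\lambda\mapsto w_\lambda$); $\Gamma_{\mathrm T}(c_{u,v}^{w,\mathbf d})=c_{u',v'}^{w',\mathbf d'}$ with $d'_i=d_{n-i}$; $\Phi_{\mathrm{Gr}}(c_{\lambda,\mu}^{\nu,d})=C_{\lambda,\mu}^{\nu\oplus d,(k)}$; $\Phi_{\mathrm{Fl}}(C_{\lambda,\mu}^{\nu\oplus d,(k)})=c_{\varphi_r(\lambda),\varphi_r(\mu)}^{\varphi_{r-s}(\eta^2)\varphi_{r+s}(\eta^1),(0^{r-s},1,\dots,s,\dots,1,0^{m-s})}$. *)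

theory Defs
  imports Main
begin

text \<open>A partition is represented by its Ferrers shape in French notation: the cell
  \<open>(i, j)\<close> lies in row \<open>i\<close> and column \<open>j\<close>, rows and columns are numbered from 1, and row 1
  is the lowest one.\<close>

type_synonym shape = "(nat \<times> nat) set"
type_synonym perm = "nat \<Rightarrow> nat"

definition is_partition :: "shape \<Rightarrow> bool" where
  "is_partition S \<longleftrightarrow> finite S \<and> S \<subseteq> {1..} \<times> {1..} \<and>
     (\<forall>i j i' j'. (i, j) \<in> S \<longrightarrow> 1 \<le> i' \<longrightarrow> i' \<le> i \<longrightarrow> 1 \<le> j' \<longrightarrow> j' \<le> j \<longrightarrow> (i', j') \<in> S)"

text \<open>This is \<open>\<lambda>\<^sub>i\<close>; it is 0 above the top row, which provides the padding by zeros.\<close>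

definition part :: "shape \<Rightarrow> nat \<Rightarrow> nat" where
  "part S i = card {j. (i, j) \<in> S}"

definition rect :: "nat \<Rightarrow> nat \<Rightarrow> shape" where
  "rect n j = {1..n - j} \<times> {1..j}"

definition compl_in :: "nat \<Rightarrow> nat \<Rightarrow> shape \<Rightarrow> shape" where
  "compl_in n j S = {(i, c). 1 \<le> i \<and> i \<le> n - j \<and> 1 \<le> c \<and> c \<le> j - part S (n - j + 1 - i)}"

definition transpose_shape :: "shape \<Rightarrow> shape" where
  "transpose_shape S = {(j, i). (i, j) \<in> S}"

definition diag0 :: "shape \<Rightarrow> nat" where
  "diag0 S = card {(i, j) \<in> S. i = j}"

text \<open>The boundary path of a partition inside \<open>(r\<^sup>m)\<close> runs down through the rows
  \<open>m, \<dots>, 1\<close>; just before the vertical step along row \<open>i\<close> there are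
  \<open>\<lambda>\<^sub>i - \<lambda>\<^sub>i\<^sub>+\<^sub>1\<close> horizontal ones.\<close>

definition bit_string :: "nat \<Rightarrow> nat \<Rightarrow> shape \<Rightarrow> nat list" where
  "bit_string m r S =
     concat (map (\<lambda>i. replicate (part S i - part S (i + 1)) 1 @ [0]) (rev [1..<m + 1])) @
     replicate (r - part S 1) 1"

definition phi_rot :: "nat \<Rightarrow> nat \<Rightarrow> nat \<Rightarrow> shape \<Rightarrow> shape" where
  "phi_rot m r a S = (THE T. is_partition T \<and> T \<subseteq> rect (m + r) r \<and>
     bit_string m r T = rotate a (bit_string m r S))"


text \<open>Permutations of \<open>{1..n}\<close> are functions fixing every other number; products are
  compositions, \<open>(u v)(i) = u (v i)\<close>.\<close>

definition one_line :: "nat list \<Rightarrow> perm" where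
  "one_line xs = (\<lambda>i. if 1 \<le> i \<and> i \<le> length xs then xs ! (i - 1) else i)"

text \<open>The decreasing block \<open>b, b - 1, \<dots>, a + 1\<close>.\<close>

definition dec_block :: "nat \<Rightarrow> nat \<Rightarrow> nat list" where
  "dec_block a b = rev [a + 1..<b + 1]"

definition w0 :: "nat \<Rightarrow> perm" where
  "w0 n = one_line (dec_block 0 n)"

definition w0P :: "nat \<Rightarrow> nat \<Rightarrow> perm" where
  "w0P m n = one_line (dec_block 0 m @ dec_block m n)"

definition w0P' :: "nat \<Rightarrow> nat \<Rightarrow> nat \<Rightarrow> perm" where
  "w0P' m n e = one_line
     (dec_block 0 (m - e) @ dec_block (m - e) m @ dec_block m (m + e) @ dec_block (m + e) n)"

definition w_perm :: "nat \<Rightarrow> nat \<Rightarrow> shape \<Rightarrow> perm" where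
  "w_perm n j S =
     (let xs = map (\<lambda>i. part S (j - i + 1) + i) [1..<j + 1]
      in one_line (xs @ sorted_list_of_set ({1..n} - set xs)))"

definition varphi :: "nat \<Rightarrow> nat \<Rightarrow> shape \<Rightarrow> perm" where
  "varphi n j S = w_perm n j (transpose_shape (compl_in n j S))"


definition adjacent :: "nat \<times> nat \<Rightarrow> nat \<times> nat \<Rightarrow> bool" where
  "adjacent x y \<longleftrightarrow>
     (fst x = fst y \<and> (snd x = snd y + 1 \<or> snd y = snd x + 1)) \<or>
     (snd x = snd y \<and> (fst x = fst y + 1 \<or> fst y = fst x + 1))"

definition connected_cells :: "shape \<Rightarrow> bool" where
  "connected_cells S \<longleftrightarrow>
     (\<forall>x\<in>S. \<forall>y\<in>S. (x, y) \<in> {(a, b). a \<in> S \<and> b \<in> S \<and> adjacent a b}\<^sup>*)"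

definition skew_shape :: "shape \<Rightarrow> bool" where
  "skew_shape S \<longleftrightarrow>
     (\<exists>inner outer. is_partition inner \<and> is_partition outer \<and> inner \<subseteq> outer \<and> S = outer - inner)"

definition rim_hook :: "nat \<Rightarrow> shape \<Rightarrow> bool" where
  "rim_hook n S \<longleftrightarrow> skew_shape S \<and> connected_cells S \<and> card S = n \<and>
     \<not> (\<exists>i j. {(i, j), (i + 1, j), (i, j + 1), (i + 1, j + 1)} \<subseteq> S)"

definition is_head :: "shape \<Rightarrow> nat \<times> nat \<Rightarrow> bool" where
  "is_head S h \<longleftrightarrow> h \<in> S \<and> (\<forall>c\<in>S. fst h \<le> fst c \<and> snd c \<le> snd h)"

definition add_rim_hook :: "nat \<Rightarrow> nat \<Rightarrow> shape \<Rightarrow> shape \<Rightarrow> bool" where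
  "add_rim_hook n r S T \<longleftrightarrow> is_partition T \<and> S \<subseteq> T \<and> rim_hook n (T - S) \<and>
     (\<exists>i. is_head (T - S) (i, r))"

definition oplus :: "nat \<Rightarrow> nat \<Rightarrow> shape \<Rightarrow> nat \<Rightarrow> shape" where
  "oplus n r nu d = (THE \<eta>. (add_rim_hook n r ^^ d) nu \<eta>)"

definition bottom_rows :: "nat \<Rightarrow> shape \<Rightarrow> shape" where
  "bottom_rows a S = {(i, j). (i, j) \<in> S \<and> i \<le> a}"

definition upper_rows :: "nat \<Rightarrow> shape \<Rightarrow> shape" where
  "upper_rows a S = {(i, j). 1 \<le> i \<and> (i + a, j) \<in> S}"

definition compl_inside :: "nat \<Rightarrow> nat \<Rightarrow> shape \<Rightarrow> shape" where
  "compl_inside n r S = compl_in n r (S \<inter> rect n r)"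

text \<open>The vector \<open>(0\<^sup>a\<^sup>-\<^sup>e, 1, \<dots>, e - 1, e, e - 1, \<dots>, 1, 0\<^sup>b\<^sup>-\<^sup>e)\<close> of length \<open>a + b - 1\<close>;
  for \<open>e = 0\<close> it is the zero vector of that length.\<close>

definition deg_vec :: "nat \<Rightarrow> nat \<Rightarrow> nat \<Rightarrow> nat list" where
  "deg_vec a b e =
     (if e = 0 then replicate (a + b - 1) 0
      else replicate (a - e) 0 @ [1..<e] @ [e] @ rev [1..<e] @ replicate (b - e) 0)"


text \<open>The correspondences act on the indices of Littlewood--Richardson coefficients, so a
  coefficient is represented by the symbol carrying these indices: \<open>Gr_LR lam mu nu d\<close> is the
  coefficient of \<open>q\<^sup>d \<sigma>\<^sub>\<nu>\<close> in \<open>\<sigma>\<^sub>\<lambda> * \<sigma>\<^sub>\<mu>\<close> in the quantum cohomology of the Grassmannian,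
  \<open>Fl_LR u v w d\<close> is the coefficient of \<open>q\<^sup>d \<sigma>\<^sub>w\<close> in \<open>\<sigma>\<^sub>u * \<sigma>\<^sub>v\<close> in the quantum cohomology of
  the flag variety, with \<open>d = [d\<^sub>1, \<dots>, d\<^sub>n\<^sub>-\<^sub>1]\<close>, and \<open>K_LR k lam mu \<eta>\<close> is the coefficient of the
  \<open>k\<close>-Schur function of \<open>\<eta>\<close> in the product of those of \<open>\<lambda>\<close> and \<open>\<mu>\<close>. The degree in \<open>Gr_LR\<close>
  is an integer because strange duality can produce a negative one.\<close>

datatype gr_lr = Gr_LR shape shape shape int
datatype fl_lr = Fl_LR perm perm perm "nat list"
datatype k_lr = K_LR nat shape shape shape

text \<open>The correspondences are partial maps: \<^const>\<open>None\<close> means that an index on the right-hand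
  side is not defined. Throughout \<open>n = m + r\<close>.\<close>

fun Gamma_SD :: "nat \<Rightarrow> nat \<Rightarrow> gr_lr \<rightharpoonup> gr_lr" where
  "Gamma_SD m r (Gr_LR lam mu nu d) =
     Some (Gr_LR (compl_in (m + r) r lam) (compl_in (m + r) r mu)
       (compl_in (m + r) r (phi_rot m r r nu))
       (int (diag0 (compl_in (m + r) r nu)) - d))"

text \<open>The Grassmannian permutation \<open>u\<close> with \<open>\<lambda>\<^sub>u = \<lambda>\<close> is \<open>w\<^sub>\<lambda>\<close>.\<close>

fun Psi_PC :: "nat \<Rightarrow> nat \<Rightarrow> gr_lr \<rightharpoonup> fl_lr" where
  "Psi_PC m r (Gr_LR lam mu nu e) =
     (if 0 \<le> e \<and> e \<le> int (min m r)
      then Some (Fl_LR (w_perm (m + r) m lam) (w_perm (m + r) m mu)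
        (w_perm (m + r) m nu \<circ> w0P m (m + r) \<circ> w0P' m (m + r) (nat e))
        (deg_vec m r (nat e)))
      else None)"

text \<open>Reversing the list is \<open>d'\<^sub>i = d\<^sub>n\<^sub>-\<^sub>i\<close>.\<close>

fun Gamma_T :: "nat \<Rightarrow> fl_lr \<rightharpoonup> fl_lr" where
  "Gamma_T n (Fl_LR u v w d) =
     Some (Fl_LR (w0 n \<circ> u \<circ> w0 n) (w0 n \<circ> v \<circ> w0 n) (w0 n \<circ> w \<circ> w0 n) (rev d))"

fun Phi_Gr :: "nat \<Rightarrow> nat \<Rightarrow> gr_lr \<rightharpoonup> k_lr" where
  "Phi_Gr m r (Gr_LR lam mu nu d) =
     (if 0 \<le> d then Some (K_LR (m + r - 1) lam mu (oplus (m + r) r nu (nat d))) else None)"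

text \<open>The side condition says that each \<open>\<phi>\<^sub>j\<close> is applied to a partition inside its
  rectangle.\<close>

fun Phi_Fl :: "nat \<Rightarrow> nat \<Rightarrow> k_lr \<rightharpoonup> fl_lr" where
  "Phi_Fl m r (K_LR k lam mu \<eta>) =
     (let n = m + r;
          s = diag0 (compl_inside n r \<eta>);
          \<eta>1 = bottom_rows (m - s) \<eta>;
          \<eta>2 = upper_rows (m - s) \<eta>
      in if lam \<subseteq> rect n r \<and> mu \<subseteq> rect n r \<and> \<eta>1 \<subseteq> rect n (r + s) \<and> \<eta>2 \<subseteq> rect n (r - s)
         then Some (Fl_LR (varphi n r lam) (varphi n r mu)
           (varphi n (r - s) \<eta>2 \<circ> varphi n (r + s) \<eta>1) (deg_vec r m s))
         else None)"

end

theory Submission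
  imports Defs
begin

text \<open>
  Everything is read off from column heights. Let \<open>c\<close> be the column heights of \<open>\<nu>\<close>. Adding an
  \<open>n\<close>-rim hook with head in column \<open>r\<close> replaces \<open>(c\<^sub>1, \<dots>, c\<^sub>r)\<close> by
  \<open>(c\<^sub>r + m + 1, c\<^sub>1 + 1, \<dots>, c\<^sub>r\<^sub>-\<^sub>1 + 1)\<close>. Each such step fills exactly one cell of the diagonal
  through the corner \<open>(m, r)\<close> as long as that diagonal has an empty cell inside \<open>R\<^sub>r\<close>, hence
  \<open>s = max t 0\<close>; if \<open>t < 0\<close>, the shape is higher than \<open>2m\<close> and both sides are undefined.

  The numbers \<open>2m - c\<^sub>i + i\<close> modulo \<open>n\<close> are permuted by a step. Since the ones of the bit string of a
  partition \<open>\<rho>\<close> with columns \<open>e\<close> are at the positions \<open>m - e\<^sub>i + i\<close>, which are also the first \<open>r\<close>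
  values of \<open>varphi n r \<rho>\<close>, this determines the columns of \<open>\<phi>\<^sup>r(\<nu>)\<close> from those of \<open>\<nu> \<oplus> d\<close>. Both products of
  permutations are then \<open>varphi n r (\<phi>\<^sup>r(\<nu>))\<close> composed with the same exchange of blocks: after undoing
  the exchange they agree on \<open>1, \<dots>, r\<close> and increase on \<open>r + 1, \<dots>, n\<close>.
\<close>

section \<open>Column heights\<close>

definition col :: "shape \<Rightarrow> nat \<Rightarrow> nat" where
  "col S j = card {i. (i, j) \<in> S}"

definition shape_of :: "nat \<Rightarrow> (nat \<Rightarrow> nat) \<Rightarrow> shape" where
  "shape_of r c = {(i, j). 1 \<le> i \<and> 1 \<le> j \<and> j \<le> r \<and> i \<le> c j}"

lemma mem_shape_of [simp]: "(i, j) \<in> shape_of r c \<longleftrightarrow> 1 \<le> i \<and> 1 \<le> j \<and> j \<le> r \<and> i \<le> c j"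
  by (simp add: shape_of_def)

text \<open>Applied to a row or a column of a partition, this turns the cardinalities in
  \<open>part\<close> and \<open>col\<close> into bounds that decide membership.\<close>

lemma initial_segment_eq:
  fixes A :: "nat set"
  assumes "finite A" and "0 \<notin> A" and "\<And>x y. x \<in> A \<Longrightarrow> 1 \<le> y \<Longrightarrow> y \<le> x \<Longrightarrow> y \<in> A"
  shows "A = {1..card A}"
proof (cases "A = {}")
  case False
  have "A = {1..Max A}"
  proof
    show "A \<subseteq> {1..Max A}"
      using assms(1,2) by (auto simp: Suc_le_eq intro!: gr0I)
    show "{1..Max A} \<subseteq> A"
      using assms(3)[OF Max_in[OF assms(1) False]] by auto
  qed
  then show ?thesis
    by (metis card_atLeastAtMost diff_Suc_1)
qed simp

lemma is_partition_transpose: "is_partition S \<Longrightarrow> is_partition (transpose_shape S)"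
proof -
  assume "is_partition S"
  moreover have "transpose_shape S = prod.swap ` S"
    by (force simp: transpose_shape_def)
  ultimately show ?thesis
    unfolding is_partition_def transpose_shape_def by auto
qed

lemma part_transpose: "part (transpose_shape S) = col S"
  by (simp add: fun_eq_iff part_def col_def transpose_shape_def)

lemma mem_iff_part:
  assumes "is_partition S"
  shows "(i, j) \<in> S \<longleftrightarrow> 1 \<le> i \<and> 1 \<le> j \<and> j \<le> part S i"
proof -
  have fin: "finite {j. (i, j) \<in> S}"
    using assms finite_vimageI[of S "Pair i"] by (auto simp: is_partition_def inj_on_def vimage_def)
  have pos: "(i, j) \<in> S \<Longrightarrow> 1 \<le> i \<and> 1 \<le> j" for j
    using assms by (auto simp: is_partition_def)
  have down: "(i, x) \<in> S \<Longrightarrow> 1 \<le> y \<Longrightarrow> y \<le> x \<Longrightarrow> (i, y) \<in> S" for x y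
    using assms pos unfolding is_partition_def by blast
  have "{j. (i, j) \<in> S} = {1..part S i}"
    unfolding part_def
  proof (rule initial_segment_eq[OF fin])
    show "0 \<notin> {j. (i, j) \<in> S}"
      using pos[of 0] by auto
  qed (use down in blast)
  then have "(i, j) \<in> S \<longleftrightarrow> 1 \<le> j \<and> j \<le> part S i"
    by (simp add: set_eq_iff)
  then show ?thesis
    using pos by blast
qed

lemma mem_iff_col:
  assumes "is_partition S"
  shows "(i, j) \<in> S \<longleftrightarrow> 1 \<le> i \<and> 1 \<le> j \<and> i \<le> col S j"
  using mem_iff_part[OF is_partition_transpose[OF assms], of j i]
  unfolding part_transpose by (auto simp: transpose_shape_def)

lemma part_unique:
  assumes "\<And>j. (i, j) \<in> S \<longleftrightarrow> 1 \<le> j \<and> j \<le> p"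
  shows "part S i = p"
  using assms by (simp add: part_def atLeastAtMost_def[symmetric] Collect_conj_eq atLeast_def[symmetric] atMost_def[symmetric])

lemma col_unique:
  assumes "\<And>i. (i, j) \<in> S \<longleftrightarrow> 1 \<le> i \<and> i \<le> p"
  shows "col S j = p"
  using part_unique[of j "transpose_shape S" p] assms
  unfolding part_transpose by (simp add: transpose_shape_def)

lemma col_shape_of: "1 \<le> j \<Longrightarrow> j \<le> r \<Longrightarrow> col (shape_of r c) j = c j"
  by (rule col_unique) auto

lemma finite_shape_of: "finite (shape_of r c)"
proof -
  have "shape_of r c = (\<lambda>(j, i). (i, j)) ` (SIGMA j:{1..r}. {1..c j})"
    by (auto simp: image_def)
  then show ?thesis by simp
qed

lemma antimono_on_intervalD:
  fixes c :: "nat \<Rightarrow> nat"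
  assumes "antimono_on {1..r} c" and "1 \<le> i" and "i \<le> j" and "j \<le> r"
  shows "c j \<le> c i"
  using monotone_onD[OF assms(1), of i j] assms(2-) by auto

lemma is_partition_shape_of: "antimono_on {1..r} c \<Longrightarrow> is_partition (shape_of r c)"
proof -
  assume "antimono_on {1..r} c"
  note mono = antimono_on_intervalD[OF this]
  have "c j \<le> c j'" if "1 \<le> j'" "j' \<le> j" "j \<le> r" for j j'
    using that by (rule mono)
  then show ?thesis
    unfolding is_partition_def using finite_shape_of by (auto, meson order_trans)
qed

lemma shape_of_col:
  assumes "is_partition S" and "\<And>i j. (i, j) \<in> S \<Longrightarrow> j \<le> r"
  shows "shape_of r (col S) = S"
proof -
  have "(i, j) \<in> shape_of r (col S) \<longleftrightarrow> (i, j) \<in> S" for i j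
    using assms(2)[of i j] mem_iff_col[OF assms(1), of i j] by auto
  then show ?thesis by auto
qed

lemma antimono_col:
  assumes "is_partition S"
  shows "antimono_on {1..r} (col S)"
proof (rule monotone_onI)
  fix i j assume *: "i \<in> {1..r}" "j \<in> {1..r}" "i \<le> j"
  show "col S j \<le> col S i"
  proof (cases "col S j = 0")
    case False
    then have "(col S j, j) \<in> S"
      using mem_iff_col[OF assms] * by auto
    then have "(col S j, i) \<in> S"
      using assms * False unfolding is_partition_def by fastforce
    then show ?thesis
      using mem_iff_col[OF assms] by auto
  qed simp
qed

lemma col_le_of_subset_rect:
  assumes "S \<subseteq> rect (m + r) r"
  shows "col S j \<le> m"
proof -
  have "{i. (i, j) \<in> S} \<subseteq> {1..m}"
    using assms by (auto simp: rect_def)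
  then show ?thesis
    unfolding col_def by (metis card_atLeastAtMost card_mono diff_Suc_1 finite_atLeastAtMost)
qed

lemma card_columns:
  assumes "\<And>i j. (i, j) \<in> S \<longleftrightarrow> j \<in> J \<and> a j < i \<and> i \<le> b j" and "finite J"
  shows "card S = (\<Sum>j\<in>J. b j - a j)"
proof -
  have "S = (\<lambda>(j, i). (i, j)) ` (SIGMA j:J. {a j<..b j})"
    using assms(1) by (auto simp: image_def)
  moreover have "inj_on (\<lambda>(j, i). (i, j)) (SIGMA j:J. {a j<..b j})"
    by (auto simp: inj_on_def)
  ultimately show ?thesis
    using assms(2) by (simp add: card_image)
qed

section \<open>Adding rim hooks\<close>

text \<open>Extend \<open>c\<close> to all integers by giving column \<open>j - r\<close> the height
  of column \<open>j\<close> plus \<open>m\<close>. Adding a hook then moves every column one place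
  to the right and raises it by 1; the formula for column 1 is the wrap-around of column
  \<open>r\<close>.\<close>

definition add_hook :: "nat \<Rightarrow> nat \<Rightarrow> (nat \<Rightarrow> nat) \<Rightarrow> nat \<Rightarrow> nat" where
  "add_hook m r c j = (if j = 1 then c r + m + 1 else c (j - 1) + 1)"

text \<open>For positive \<open>r\<close> these are the heights whose periodic extension is weakly
  decreasing: the second conjunct compares column 1 with the copy of column \<open>r\<close> to its
  left.\<close>

definition cyclic_columns :: "nat \<Rightarrow> nat \<Rightarrow> (nat \<Rightarrow> nat) \<Rightarrow> bool" where
  "cyclic_columns m r c \<longleftrightarrow> antimono_on {1..r} c \<and> c 1 \<le> c r + m"

lemma cyclic_columns_add_hook:
  assumes "cyclic_columns m r c" and "1 \<le> r"
  shows "cyclic_columns m r (add_hook m r c)"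
proof -
  have mono: "c j \<le> c i" if "1 \<le> i" "i \<le> j" "j \<le> r" for i j
    using assms(1) that by (auto simp: cyclic_columns_def intro: antimono_on_intervalD)
  have top: "c j \<le> c r + m" if "1 \<le> j" "j \<le> r" for j
    using mono[of 1 j] that assms by (auto simp: cyclic_columns_def)
  have "add_hook m r c j \<le> add_hook m r c i" if "1 \<le> i" "i \<le> j" "j \<le> r" for i j
    using that top[of "j - 1"] mono[of "i - 1" "j - 1"] by (auto simp: add_hook_def)
  moreover have "add_hook m r c 1 \<le> add_hook m r c r + m"
    using assms mono[of "r - 1" r] by (auto simp: add_hook_def)
  ultimately show ?thesis
    by (auto simp: cyclic_columns_def intro!: monotone_onI)
qed

lemma sum_add_hook:
  assumes "1 \<le> r"
  shows "(\<Sum>j=1..r. add_hook m r c j) = (\<Sum>j=1..r. c j) + m + r"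
proof -
  \<comment> \<open>The wrap-around value \<open>c r\<close> stays fixed while the number of columns
    grows, so that induction on \<open>k\<close> applies.\<close>
  have "(\<Sum>j=1..k+1. add_hook m r c j) = c r + m + 1 + (\<Sum>j=1..k. c j) + k" for k
    by (induction k) (auto simp: add_hook_def)
  from this[of "r - 1"] show ?thesis
    using assms sum.atLeast_Suc_atMost[of 1 r] by (cases r) (auto simp: add_hook_def)
qed

text \<open>The hook meets every column: monotonicity gives this from column 2 on, the cyclic bound
  gives it in column 1.\<close>

lemma less_add_hook:
  assumes "cyclic_columns m r c" and "1 \<le> j" and "j \<le> r"
  shows "c j < add_hook m r c j"
  using assms antimono_on_intervalD[of r c "j - 1" j]
  by (auto simp: cyclic_columns_def add_hook_def less_Suc_eq_le)

text \<open>The hook meets column \<open>j\<close> in the rows above \<open>c\<^sub>j\<close> up to \<open>c\<^sub>j\<^sub>-\<^sub>1 + 1\<close>, so its columns overlap in a single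
  row each, and walking down and to the right leads to the head.\<close>

lemma rim_hook_add_hook:
  assumes c: "cyclic_columns m r c" and r: "1 \<le> r"
  shows "add_rim_hook (m + r) r (shape_of r c) (shape_of r (add_hook m r c))"
proof -
  define b where "b = add_hook m r c"
  let ?S = "shape_of r c" and ?T = "shape_of r b"
  note lt = less_add_hook[OF c, folded b_def]
  have mono: "c j \<le> c i" if "1 \<le> i" "i \<le> j" "j \<le> r" for i j
    using c that by (auto simp: cyclic_columns_def intro: antimono_on_intervalD)
  have mem: "(i, j) \<in> ?T - ?S \<longleftrightarrow> j \<in> {1..r} \<and> c j < i \<and> i \<le> b j" for i j
    by auto
  have partS: "is_partition ?S"
    using c by (simp add: cyclic_columns_def is_partition_shape_of)
  have partT: "is_partition ?T"
    using cyclic_columns_add_hook[OF c r] by (simp add: b_def cyclic_columns_def is_partition_shape_of)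
  have sub: "?S \<subseteq> ?T"
    using lt by (auto, meson less_imp_le order_trans)
  have "card (?T - ?S) = (\<Sum>j=1..r. b j - c j)"
    by (rule card_columns) (use mem in auto)
  also have "\<dots> = (\<Sum>j=1..r. b j) - (\<Sum>j=1..r. c j)"
    by (rule sum_subtractf_nat) (use lt in \<open>auto intro: less_imp_le\<close>)
  also have "\<dots> = m + r"
    using sum_add_hook[OF r] by (simp add: b_def)
  finally have card: "card (?T - ?S) = m + r" .
  have flat: "\<not> {(i, j), (i + 1, j), (i, j + 1), (i + 1, j + 1)} \<subseteq> ?T - ?S" for i j
    by (auto simp: b_def add_hook_def split: if_splits)
  let ?E = "{(x, y). x \<in> ?T - ?S \<and> y \<in> ?T - ?S \<and> adjacent x y}"
  \<comment> \<open>The walk goes down as long as the column has a lower hook cell and otherwise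
    right; either move decreases \<open>i + (r - j)\<close>.\<close>
  have to_head: "((i, j), (c r + 1, r)) \<in> ?E\<^sup>*" if "(i, j) \<in> ?T - ?S" for i j
    using that
  proof (induction "i + (r - j)" arbitrary: i j rule: less_induct)
    case less
    then have ij: "1 \<le> j" "j \<le> r" "c j < i" "i \<le> b j" by auto
    consider "i > c j + 1" | "i = c j + 1" "j < r" | "i = c j + 1" "j = r"
      using ij by linarith
    then show ?case
    proof cases
      case 1
      then have *: "(i - 1, j) \<in> ?T - ?S" using ij by auto
      then have "((i, j), (i - 1, j)) \<in> ?E"
        using less.prems 1 by (simp add: adjacent_def)
      then show ?thesis
        using less.hyps[OF _ *] 1 ij(2) by (intro converse_rtrancl_into_rtrancl[of "(i, j)"]) auto
    next
      case 2
      then have *: "(i, j + 1) \<in> ?T - ?S"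
        using ij mono[of j "j + 1"] by (auto simp: b_def add_hook_def)
      then have "((i, j), (i, j + 1)) \<in> ?E"
        using less.prems by (simp add: adjacent_def)
      then show ?thesis
        using less.hyps[OF _ *] 2 by (intro converse_rtrancl_into_rtrancl[of "(i, j)"]) auto
    qed simp
  qed
  \<comment> \<open>Paths can be reversed, so any two cells are joined through the head.\<close>
  have "sym ?E"
    by (auto simp: sym_def adjacent_def)
  then have "connected_cells (?T - ?S)"
    unfolding connected_cells_def using to_head sym_rtrancl[of ?E]
    by (metis (no_types, lifting) prod.collapse rtrancl_trans symE)
  then have "rim_hook (m + r) (?T - ?S)"
    unfolding rim_hook_def skew_shape_def using partS partT sub card flat by blast
  moreover have "is_head (?T - ?S) (c r + 1, r)"
    unfolding is_head_def using lt[of r] mono[of _ r] r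
    by (auto simp: Suc_le_eq not_le) (meson le_less_trans)
  ultimately show ?thesis
    unfolding add_rim_hook_def b_def[symmetric] using partT sub by blast
qed

text \<open>Without a \<open>2 \<times> 2\<close> square, column \<open>j + 1\<close> ends at height at most \<open>c\<^sub>j + 1\<close>. If it ended below, the
  hook would by connectedness lie to the right of column \<open>j\<close>, and then it would have fewer than
  \<open>n\<close> cells.\<close>

lemma add_rim_hook_unique:
  assumes c: "cyclic_columns m r c" and r: "1 \<le> r"
    and T: "add_rim_hook (m + r) r (shape_of r c) T"
  shows "T = shape_of r (add_hook m r c)"
proof -
  define b where "b = col T"
  let ?S = "shape_of r c"
  have partT: "is_partition T" and sub: "?S \<subseteq> T" and hook: "rim_hook (m + r) (T - ?S)"
    using T by (auto simp: add_rim_hook_def)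
  obtain h where head: "is_head (T - ?S) (h, r)"
    using T by (auto simp: add_rim_hook_def)
  have "j \<le> r" if "(i, j) \<in> T" for i j
  proof (cases "(i, j) \<in> ?S")
    case False
    with that have "(i, j) \<in> T - ?S" by blast
    with head show ?thesis unfolding is_head_def by (metis snd_conv)
  qed simp
  then have Tb: "T = shape_of r b"
    unfolding b_def using shape_of_col[OF partT, of r] by auto
  have monoc: "c j \<le> c i" if "1 \<le> i" "i \<le> j" "j \<le> r" for i j
    using c that by (auto simp: cyclic_columns_def intro: antimono_on_intervalD)
  have monob: "b j \<le> b i" if "1 \<le> i" "i \<le> j" "j \<le> r" for i j
    using antimono_col[OF partT, of r] that by (auto simp: b_def intro: antimono_on_intervalD)
  have top: "c j \<le> c r + m" if "1 \<le> j" "j \<le> r" for j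
    using monoc[of 1 j] that c by (auto simp: cyclic_columns_def)
  have cb: "c j \<le> b j" if "1 \<le> j" "j \<le> r" for j
    using subsetD[OF sub, of "(c j, j)"] that by (cases "c j = 0") (auto simp: Tb)
  have mem: "(i, j) \<in> T - ?S \<longleftrightarrow> j \<in> {1..r} \<and> c j < i \<and> i \<le> b j" for i j
    by (auto simp: Tb)
  have upper: "b (j + 1) \<le> c j + 1" if "1 \<le> j" "j < r" for j
  proof (rule ccontr)
    assume "\<not> ?thesis"
    then have "{(c j + 1, j), (c j + 1 + 1, j), (c j + 1, j + 1), (c j + 1 + 1, j + 1)} \<subseteq> T - ?S"
      using that monob[of j "j + 1"] monoc[of j "j + 1"] by (auto simp: mem simp del: Diff_iff)
    then show False
      using hook unfolding rim_hook_def by blast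
  qed
  \<comment> \<open>Adding up \<open>upper\<close> bounds the number of hook cells in the columns
    \<open>k\<close> to \<open>r\<close> by \<open>b k - c r + (r - k)\<close>.\<close>
  have telescope: "(\<Sum>i=k..r. b i) + c r \<le> b k + (\<Sum>i=k..r. c i) + (r - k)"
    if "k \<le> r" "1 \<le> k" for k
    using that
  proof (induction rule: inc_induct)
    case (step k)
    then show ?case
      using upper[of k] by (simp add: sum.atLeast_Suc_atMost[of k])
  qed simp
  have card: "card (T - ?S) = m + r"
    using hook by (simp add: rim_hook_def)
  have eq: "b (j + 1) = c j + 1" if j: "1 \<le> j" "j < r" for j
  proof (rule ccontr)
    assume "b (j + 1) \<noteq> c j + 1"
    with upper[OF j] have gap: "b (j + 1) \<le> c j" by simp
    \<comment> \<open>By \<open>gap\<close>, the columns \<open>j\<close> and \<open>j + 1\<close>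
      of the hook have no row in common, so no path of hook cells leads from column \<open>j\<close>
      or earlier to the head in column \<open>r > j\<close>.\<close>
    have right: "j < j'" if x: "(i, j') \<in> T - ?S" for i j'
    proof (rule ccontr)
      assume "\<not> j < j'"
      have "((i, j'), (h, r)) \<in> {(x, y). x \<in> T - ?S \<and> y \<in> T - ?S \<and> adjacent x y}\<^sup>*"
        using hook head x by (auto simp: rim_hook_def connected_cells_def is_head_def)
      then have "snd (h, r) \<le> j"
      proof (induction rule: rtrancl_induct)
        case base
        then show ?case using \<open>\<not> j < j'\<close> by simp
      next
        case (step y z)
        then obtain iy jy iz jz where yz: "y = (iy, jy)" "z = (iz, jz)"
            "(iy, jy) \<in> T - ?S" "(iz, jz) \<in> T - ?S" "adjacent (iy, jy) (iz, jz)" "jy \<le> j"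
          by (cases y, cases z) auto
        have False if "jz > j"
        proof -
          have "jy = j" "jz = j + 1" "iy = iz"
            using yz that by (auto simp: adjacent_def)
          then show False
            using yz(3,4) gap unfolding mem by auto
        qed
        then show ?case
          using yz(2) by fastforce
      qed
      then show False using j by simp
    qed
    have "card (T - ?S) = (\<Sum>i=j+1..r. b i - c i)"
      using right by (intro card_columns) (auto simp: mem simp del: Diff_iff, fastforce+)
    also have "\<dots> = (\<Sum>i=j+1..r. b i) - (\<Sum>i=j+1..r. c i)"
      using j by (intro sum_subtractf_nat) (auto intro: cb)
    \<comment> \<open>\<open>telescope\<close> together with \<open>gap\<close> and
      \<open>top\<close> leaves at most \<open>m + r - j - 1\<close> cells.\<close>
    finally have "card (T - ?S) < m + r"
      using telescope[of "j + 1"] gap top[of j] j by linarith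
    then show False using card by simp
  qed
  \<comment> \<open>Once the later columns are known, the number of cells of the hook determines
    column 1.\<close>
  have "m + r = (\<Sum>i=1..r. b i - c i)"
    unfolding card[symmetric] by (intro card_columns) (auto simp: mem simp del: Diff_iff)
  also have "\<dots> = (\<Sum>i=1..r. b i) - (\<Sum>i=1..r. c i)"
    by (intro sum_subtractf_nat) (auto intro: cb)
  finally have "(\<Sum>i=1..r. b i) = (\<Sum>i=1..r. add_hook m r c i)"
    using sum_add_hook[OF r, of m c] r by auto
  moreover have rest: "b j = add_hook m r c j" if "2 \<le> j" "j \<le> r" for j
    using eq[of "j - 1"] that by (simp add: add_hook_def)
  ultimately have "b 1 = add_hook m r c 1"
    using r sum.cong[of "{2..r}" "{2..r}" b "add_hook m r c"]
    by (simp add: sum.atLeast_Suc_atMost numeral_2_eq_2)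
  with rest have "b j = add_hook m r c j" if "1 \<le> j" "j \<le> r" for j
    using that by (cases "j = 1") auto
  then show ?thesis
    unfolding Tb by (auto simp: shape_of_def)
qed

lemma cyclic_columns_funpow:
  assumes "cyclic_columns m r c" and "1 \<le> r \<or> d = 0"
  shows "cyclic_columns m r ((add_hook m r ^^ d) c)"
  using assms(2)
proof (induction d)
  case (Suc d)
  then show ?case
    using cyclic_columns_add_hook[of m r "(add_hook m r ^^ d) c"] by simp
qed (simp add: assms(1))

text \<open>Existence and uniqueness of each hook make the relation a function on these shapes,
  which justifies the description operator in \<open>oplus\<close>. The alternative
  \<open>d = 0\<close> covers \<open>r = 0\<close>, where no column can hold a head.\<close>

lemma add_rim_hook_relpowp_iff:
  assumes "cyclic_columns m r c" and "1 \<le> r \<or> d = 0"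
  shows "(add_rim_hook (m + r) r ^^ d) (shape_of r c) T \<longleftrightarrow>
    T = shape_of r ((add_hook m r ^^ d) c)"
  using assms(2)
proof (induction d arbitrary: T)
  case (Suc d)
  then have "(add_rim_hook (m + r) r ^^ Suc d) (shape_of r c) T \<longleftrightarrow>
      add_rim_hook (m + r) r (shape_of r ((add_hook m r ^^ d) c)) T"
    by (auto simp: OO_def)
  also have "\<dots> \<longleftrightarrow> T = shape_of r ((add_hook m r ^^ Suc d) c)"
    using Suc.prems cyclic_columns_funpow[OF assms(1), of d]
      rim_hook_add_hook[of m r "(add_hook m r ^^ d) c"]
      add_rim_hook_unique[of m r "(add_hook m r ^^ d) c" T] by auto
  finally show ?case .
next
  case 0
  show ?case by (simp, rule eq_commute)
qed

section \<open>Empty cells on the diagonal\<close>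

text \<open>Cell \<open>i\<close> of the diagonal, counted from the corner \<open>(m, r)\<close>, is \<open>(m + 1 - i, r + 1 - i)\<close>; exactly
  the cells \<open>1, \<dots>, s\<close> are empty.\<close>

definition diag_gap :: "nat \<Rightarrow> nat \<Rightarrow> (nat \<Rightarrow> nat) \<Rightarrow> nat \<Rightarrow> bool" where
  "diag_gap m r c s \<longleftrightarrow> s \<le> r \<and> (0 < s \<longrightarrow> c (r + 1 - s) + s \<le> m) \<and> (s < r \<longrightarrow> m \<le> c (r - s) + s)"

lemma diag_gap_exists: "\<exists>s. diag_gap m r c s"
proof -
  define P where "P i \<longleftrightarrow> i = 0 \<or> (i \<le> r \<and> c (r + 1 - i) + i \<le> m)" for i
  define s where "s = (GREATEST i. P i)"
  have bound: "i \<le> r" if "P i" for i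
    using that by (auto simp: P_def)
  have "P s"
    unfolding s_def by (rule GreatestI_nat[of P 0 r]) (auto simp: P_def)
  moreover have "\<not> P (Suc s)"
    using Greatest_le_nat[of P "Suc s" r] bound by (auto simp: s_def)
  ultimately show ?thesis
    by (intro exI[of _ s]) (auto simp: P_def diag_gap_def)
qed

text \<open>Complementation turns the rectangle by 180 degrees, so the cell \<open>(i, i)\<close> of
  the complement is the empty cell \<open>i\<close> of the diagonal counted from the corner
  \<open>(m, r)\<close>.\<close>

lemma diag0_compl_inside:
  assumes anti: "antimono_on {1..r} c" and gap: "diag_gap m r c s"
  shows "diag0 (compl_inside (m + r) r (shape_of r c)) = s"
proof -
  let ?S = "shape_of r c \<inter> rect (m + r) r"
  have "?S = shape_of r (\<lambda>j. min m (c j))"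
    by (auto simp: rect_def)
  moreover have "antimono_on {1..r} (\<lambda>j. min m (c j))"
    using antimono_on_intervalD[OF anti] by (auto intro!: monotone_onI simp: min_le_iff_disj)
  ultimately have part: "is_partition ?S"
    by (simp add: is_partition_shape_of)
  have "(i, i) \<in> compl_in (m + r) r ?S \<longleftrightarrow> i \<in> {1..s}" for i
  proof -
    have "(i, i) \<in> compl_in (m + r) r ?S \<longleftrightarrow> 1 \<le> i \<and> i \<le> m \<and> i \<le> r \<and> \<not> r + 1 - i \<le> part ?S (m + 1 - i)"
      by (auto simp: compl_in_def)
    also have "\<dots> \<longleftrightarrow> 1 \<le> i \<and> i \<le> m \<and> i \<le> r \<and> (m + 1 - i, r + 1 - i) \<notin> ?S"
      using mem_iff_part[OF part, of "m + 1 - i" "r + 1 - i"] by auto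
    also have "\<dots> \<longleftrightarrow> 1 \<le> i \<and> i \<le> r \<and> c (r + 1 - i) + i \<le> m"
      by (auto simp: rect_def)
    \<comment> \<open>Monotonicity carries the two inequalities of \<open>diag_gap\<close>, for the
      cells \<open>s\<close> and \<open>s + 1\<close>, to all other cells.\<close>
    also have "\<dots> \<longleftrightarrow> i \<in> {1..s}"
    proof (cases "1 \<le> i \<and> i \<le> r")
      case True
      show ?thesis
      proof (cases "i \<le> s")
        case le: True
        then have "c (r + 1 - i) \<le> c (r + 1 - s)"
          using True gap by (intro antimono_on_intervalD[OF anti]) (auto simp: diag_gap_def)
        then show ?thesis
          using True le gap by (auto simp: diag_gap_def)
      next
        case False
        then have "c (r - s) \<le> c (r + 1 - i)"
          using True by (intro antimono_on_intervalD[OF anti]) auto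
        then show ?thesis
          using True False gap by (auto simp: diag_gap_def)
      qed
    qed (use gap in \<open>auto simp: diag_gap_def\<close>)
    finally show ?thesis .
  qed
  then have "{(i, j) \<in> compl_in (m + r) r ?S. i = j} = (\<lambda>i. (i, i)) ` {1..s}"
    unfolding set_eq_iff by (simp only: image_iff mem_Collect_eq split_paired_all) auto
  moreover have "inj_on (\<lambda>i::nat. (i, i)) {1..s}"
    by (simp add: inj_on_def)
  ultimately show ?thesis
    unfolding diag0_def compl_inside_def by (simp only: card_image card_atLeastAtMost)
qed

text \<open>For \<open>i < r\<close>, moving the columns right and raising them by 1 makes cell
  \<open>i\<close> empty exactly when cell \<open>i + 1\<close> was empty before; cell
  \<open>r\<close> is filled because the new first column is higher than \<open>m\<close>. Truncated
  subtraction covers the case that nothing was empty.\<close>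

lemma diag_gap_add_hook:
  assumes "cyclic_columns m r c" and "diag_gap m r c s" and "1 \<le> r"
  shows "diag_gap m r (add_hook m r c) (s - 1)"
proof (cases s)
  case 0
  have low: "m \<le> c j" if "1 \<le> j" "j \<le> r" for j
    using 0 assms that antimono_on_intervalD[of r c j r]
    by (auto simp: diag_gap_def cyclic_columns_def)
  have "m \<le> add_hook m r c r"
    using low[of "r - 1"] assms(3) by (cases "r = 1") (auto simp: add_hook_def le_SucI)
  then show ?thesis
    using 0 by (simp add: diag_gap_def)
next
  case (Suc s')
  then show ?thesis
    using assms by (auto simp: diag_gap_def add_hook_def Suc_diff_le)
qed

lemma diag_gap_funpow:
  assumes "cyclic_columns m r c" and "diag_gap m r c D" and "1 \<le> r \<or> d = 0"
  shows "diag_gap m r ((add_hook m r ^^ d) c) (D - d)"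
  using assms(3)
proof (induction d)
  case (Suc d)
  then show ?case
    using diag_gap_add_hook[OF cyclic_columns_funpow[OF assms(1), of d], of "D - d"] by simp
qed (use assms in simp)

text \<open>Before the last hook some diagonal cell is still empty, so column \<open>r\<close> is
  lower than \<open>m\<close>; the hook brings it to the front and raises it by
  \<open>m + 1\<close>.\<close>

lemma height_funpow_le:
  assumes "cyclic_columns m r c" and "diag_gap m r c D" and "1 \<le> r \<or> d = 0" and "c 1 \<le> 2 * m"
    and "d \<le> D"
  shows "(add_hook m r ^^ d) c 1 \<le> 2 * m"
proof (cases d)
  case (Suc d')
  then have gap: "diag_gap m r ((add_hook m r ^^ d') c) (D - d')" and pos: "0 < D - d'"
    using diag_gap_funpow[OF assms(1,2), of d'] assms(3,5) by auto
  let ?c = "(add_hook m r ^^ d') c"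
  have "?c r \<le> ?c (r + 1 - (D - d'))"
    using cyclic_columns_funpow[OF assms(1), of d'] gap pos assms(3) Suc
    by (intro antimono_on_intervalD[of r ?c "r + 1 - (D - d')" r]) (auto simp: cyclic_columns_def diag_gap_def)
  then have "?c r + 1 \<le> m"
    using gap pos by (auto simp: diag_gap_def)
  then show ?thesis
    using Suc by (simp add: add_hook_def)
qed (use assms in simp)

text \<open>After \<open>D\<close> or more hooks no diagonal cell is empty, so column
  \<open>r\<close> has height at least \<open>m\<close>, and a further hook produces a first column
  of height at least \<open>2 * m + 1\<close>.\<close>

lemma height_funpow_gt:
  assumes "cyclic_columns m r c" and "diag_gap m r c D" and "1 \<le> r" and "D < d"
  shows "2 * m < (add_hook m r ^^ d) c 1"
proof -
  obtain d' where d: "d = Suc d'" "D \<le> d'"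
    using assms(4) by (cases d) auto
  then have "diag_gap m r ((add_hook m r ^^ d') c) 0"
    using diag_gap_funpow[OF assms(1,2), of d'] assms(3) by simp
  then show ?thesis
    using assms(3) d by (simp add: diag_gap_def add_hook_def)
qed

section \<open>Permutations increasing on a final segment\<close>

text \<open>Permutations without a descent after position \<open>j\<close>. They are determined by
  their first \<open>j\<close> values, which is how all identities of permutations below are
  proved.\<close>

definition tail_increasing :: "nat \<Rightarrow> nat \<Rightarrow> perm \<Rightarrow> bool" where
  "tail_increasing n j g \<longleftrightarrow>
     bij_betw g {1..n} {1..n} \<and> strict_mono_on {j<..n} g \<and> (\<forall>i. i \<notin> {1..n} \<longrightarrow> g i = i)"

text \<open>At the first disagreement the smaller value would have to be taken by the other
  function: earlier is excluded by induction and injectivity, later by monotonicity.\<close>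

lemma strict_mono_on_same_image:
  fixes f g :: "nat \<Rightarrow> nat"
  assumes f: "strict_mono_on A f" and g: "strict_mono_on A g" and im: "f ` A = g ` A" and "x \<in> A"
  shows "f x = g x"
  using \<open>x \<in> A\<close>
proof (induction x rule: less_induct)
  case (less x)
  have *: "\<not> h x < k x"
    if h: "strict_mono_on A h" and k: "strict_mono_on A k" and im: "h ` A = k ` A"
      and IH: "\<And>y. y < x \<Longrightarrow> y \<in> A \<Longrightarrow> h y = k y" for h k :: "nat \<Rightarrow> nat"
  proof
    assume lt: "h x < k x"
    obtain y where y: "y \<in> A" "h x = k y"
      using im less.prems by blast
    consider "y < x" | "y = x" | "x < y" by linarith
    then show False
    proof cases
      case 1
      then show False
        using IH[OF 1 y(1)] y strict_mono_onD[OF h y(1) less.prems 1] by simp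
    next
      case 3
      then show False
        using strict_mono_onD[OF k less.prems y(1) 3] y lt by simp
    qed (use lt y in simp)
  qed
  have "f y = g y" if "y < x" "y \<in> A" for y
    using that less.IH by blast
  then show ?case
    using *[OF f g im] *[OF g f im[symmetric]] by (metis linorder_neqE_nat)
qed

lemma image_tail:
  assumes "bij_betw f {1..n} {1..n::nat}" and "j \<le> n"
  shows "f ` {j<..n} = {1..n} - f ` {1..j}"
proof -
  have "{j<..n} = {1..n} - {1..j}" using assms(2) by auto
  then have "f ` {j<..n} = f ` {1..n} - f ` {1..j}"
    using assms inj_on_image_set_diff[of f "{1..n}" "{1..n}" "{1..j}"]
    by (auto simp: bij_betw_def)
  then show ?thesis
    using assms(1) by (simp add: bij_betw_def)
qed

lemma tail_increasing_range:
  assumes "tail_increasing n j f" and "k \<le> n"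
  shows "f ` {1..k} \<subseteq> {1..n}"
proof -
  have "f ` {1..k} \<subseteq> f ` {1..n}"
    using assms(2) by (intro image_mono) auto
  then show ?thesis
    using assms(1) by (simp add: tail_increasing_def bij_betw_def)
qed

text \<open>The first \<open>j\<close> values fix the set of the remaining ones, and there is only
  one increasing way to list that set.\<close>

lemma tail_increasing_eqI:
  assumes f: "tail_increasing n j f" and g: "tail_increasing n j g" and "j \<le> n"
    and eq: "\<And>i. 1 \<le> i \<Longrightarrow> i \<le> j \<Longrightarrow> f i = g i"
  shows "f = g"
proof
  fix i
  have "f ` {1..j} = g ` {1..j}"
    using eq by (intro image_cong) auto
  then have "f ` {j<..n} = g ` {j<..n}"
    using image_tail[of f n j] image_tail[of g n j] f g \<open>j \<le> n\<close> by (simp add: tail_increasing_def)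
  then have "f i = g i" if "i \<in> {j<..n}"
    using that f g by (intro strict_mono_on_same_image[of "{j<..n}"]) (auto simp: tail_increasing_def)
  then show "f i = g i"
    using eq[of i] f g by (cases "i \<in> {1..n}"; cases "i \<le> j") (auto simp: tail_increasing_def)
qed

lemma one_line_completion:
  assumes "distinct xs" and "set xs \<subseteq> {1..n}"
  defines "g \<equiv> one_line (xs @ sorted_list_of_set ({1..n} - set xs))"
  shows "tail_increasing n (length xs) g"
    and "\<And>i. 1 \<le> i \<Longrightarrow> i \<le> length xs \<Longrightarrow> g i = xs ! (i - 1)"
proof -
  let ?ys = "sorted_list_of_set ({1..n} - set xs)"
  let ?zs = "xs @ ?ys"
  have dist: "distinct ?zs" and set: "set ?zs = {1..n}"
    using assms(1,2) by auto
  then have len: "length ?zs = n"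
    using distinct_card[OF dist] by simp
  have nth: "g i = ?zs ! (i - 1)" if "i \<in> {1..n}" for i
    using that len by (simp add: g_def one_line_def)
  have "bij_betw (\<lambda>i. i - 1) {1..n} {..<n}"
    by (rule bij_betw_byWitness[where f' = Suc]) auto
  then have "bij_betw ((\<lambda>i. ?zs ! i) \<circ> (\<lambda>i. i - 1)) {1..n} {1..n}"
    by (rule bij_betw_trans) (use bij_betw_nth[OF dist] len set in auto)
  then have "bij_betw g {1..n} {1..n}"
    by (subst bij_betw_cong[of _ _ "(\<lambda>i. ?zs ! i) \<circ> (\<lambda>i. i - 1)"]) (simp_all add: nth)
  moreover have "strict_mono_on {length xs<..n} g"
  proof (rule strict_mono_onI)
    fix i k assume ik: "i \<in> {length xs<..n}" "k \<in> {length xs<..n}" "i < k"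
    have "?ys ! (i - 1 - length xs) < ?ys ! (k - 1 - length xs)"
      using ik len by (intro sorted_wrt_nth_less[OF strict_sorted_list_of_set]) auto
    then show "g i < g k"
      using ik nth[of i] nth[of k] by (auto simp: nth_append)
  qed
  ultimately show "tail_increasing n (length xs) g"
    using len by (auto simp: tail_increasing_def g_def one_line_def)
  show "g i = xs ! (i - 1)" if "1 \<le> i" "i \<le> length xs" for i
    using that nth[of i] len by (auto simp: nth_append)
qed

section \<open>Grassmannian permutations of partitions and of their complements\<close>

lemma w_perm_properties:
  assumes mono: "\<And>i k. 1 \<le> i \<Longrightarrow> i \<le> k \<Longrightarrow> k \<le> j \<Longrightarrow> part S k \<le> part S i"
    and bound: "\<And>i. 1 \<le> i \<Longrightarrow> i \<le> j \<Longrightarrow> part S i \<le> n - j" and "j \<le> n"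
  shows "tail_increasing n j (w_perm n j S)"
    and "\<And>i. 1 \<le> i \<Longrightarrow> i \<le> j \<Longrightarrow> w_perm n j S i = part S (j - i + 1) + i"
    and "strict_mono_on {1..j} (w_perm n j S)"
proof -
  let ?f = "\<lambda>i. part S (j - i + 1) + i"
  let ?xs = "map ?f [1..<j + 1]"
  have less: "?f i < ?f k" if "1 \<le> i" "i < k" "k \<le> j" for i k
    using mono[of "j - k + 1" "j - i + 1"] that by (simp add: add_le_less_mono)
  have "inj_on ?f {1..j}"
    using less by (intro linorder_inj_onI) (metis atLeastAtMost_iff less_irrefl, auto)
  then have dist: "distinct ?xs"
    unfolding distinct_map by (simp add: atLeastLessThanSuc_atLeastAtMost del: upt_Suc)
  have "?f i \<le> n" if "1 \<le> i" "i \<le> j" for i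
  proof -
    have "part S (j - i + 1) \<le> n - j"
      by (rule bound) (use that in auto)
    then show ?thesis
      using that \<open>j \<le> n\<close> by linarith
  qed
  then have sub: "set ?xs \<subseteq> {1..n}"
    by (auto simp del: upt_Suc)
  have w: "w_perm n j S = one_line (?xs @ sorted_list_of_set ({1..n} - set ?xs))"
    by (simp only: w_perm_def Let_def)
  show "tail_increasing n j (w_perm n j S)"
    unfolding w using one_line_completion(1)[OF dist sub] by (simp del: upt_Suc)
  show val: "w_perm n j S i = ?f i" if "1 \<le> i" "i \<le> j" for i
    unfolding w using one_line_completion(2)[OF dist sub, of i] that by (simp del: upt_Suc)
  show "strict_mono_on {1..j} (w_perm n j S)"
    using less by (intro strict_mono_onI) (auto simp: val)
qed

lemma part_antimono:
  assumes "is_partition S" and "1 \<le> i" and "i \<le> k"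
  shows "part S k \<le> part S i"
proof -
  have "transpose_shape (transpose_shape S) = S"
    by (auto simp: transpose_shape_def)
  then have "part S = col (transpose_shape S)"
    using part_transpose[of "transpose_shape S"] by simp
  then show ?thesis
    using antimono_on_intervalD[OF antimono_col[OF is_partition_transpose[OF assms(1)]], of i k k] assms(2,3)
    by simp
qed

lemma part_le_of_subset_rect:
  assumes "S \<subseteq> rect (m + r) r"
  shows "part S i \<le> r"
proof -
  have "{j. (i, j) \<in> S} \<subseteq> {1..r}"
    using assms by (auto simp: rect_def)
  then show ?thesis
    unfolding part_def by (metis card_atLeastAtMost card_mono diff_Suc_1 finite_atLeastAtMost)
qed

lemma part_compl_in:
  assumes "1 \<le> i" and "i \<le> n - j"
  shows "part (compl_in n j S) i = j - part S (n - j + 1 - i)"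
  by (rule part_unique) (use assms in \<open>auto simp: compl_in_def\<close>)

lemma col_compl_in:
  assumes "is_partition S" and "1 \<le> k" and "k \<le> j"
  shows "col (compl_in n j S) k = n - j - col S (j + 1 - k)"
proof (rule col_unique)
  fix i
  have "(i, k) \<in> compl_in n j S \<longleftrightarrow> 1 \<le> i \<and> i \<le> n - j \<and> \<not> j + 1 - k \<le> part S (n - j + 1 - i)"
    using assms(2,3) by (auto simp: compl_in_def)
  also have "\<dots> \<longleftrightarrow> 1 \<le> i \<and> i \<le> n - j \<and> (n - j + 1 - i, j + 1 - k) \<notin> S"
    using mem_iff_part[OF assms(1), of "n - j + 1 - i" "j + 1 - k"] assms(2,3) by auto
  also have "\<dots> \<longleftrightarrow> 1 \<le> i \<and> i \<le> n - j - col S (j + 1 - k)"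
    using mem_iff_col[OF assms(1), of "n - j + 1 - i" "j + 1 - k"] assms(2,3) by auto
  finally show "(i, k) \<in> compl_in n j S \<longleftrightarrow> 1 \<le> i \<and> i \<le> n - j - col S (j + 1 - k)" .
qed

text \<open>Complementation reverses the order of the columns and \<open>w_perm\<close> reads the
  parts backwards; the two reversals cancel, so value \<open>i\<close> depends on column
  \<open>i\<close>.\<close>

lemma varphi_properties:
  assumes S: "is_partition S" and "j \<le> n"
  shows "tail_increasing n j (varphi n j S)"
    and "\<And>i. 1 \<le> i \<Longrightarrow> i \<le> j \<Longrightarrow> varphi n j S i = n - j - col S i + i"
    and "strict_mono_on {1..j} (varphi n j S)"
proof -
  let ?U = "transpose_shape (compl_in n j S)"
  have part: "part ?U i = n - j - col S (j + 1 - i)" if "1 \<le> i" "i \<le> j" for i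
    using col_compl_in[OF S that] by (simp add: part_transpose)
  have "part ?U k \<le> part ?U i" if "1 \<le> i" "i \<le> k" "k \<le> j" for i k
    using that antimono_on_intervalD[OF antimono_col[OF S, of j], of "j + 1 - k" "j + 1 - i"]
    by (simp add: part diff_le_mono2)
  moreover have "part ?U i \<le> n - j" if "1 \<le> i" "i \<le> j" for i
    using that by (simp add: part)
  ultimately have *: "tail_increasing n j (w_perm n j ?U)" "strict_mono_on {1..j} (w_perm n j ?U)"
      "\<And>i. 1 \<le> i \<Longrightarrow> i \<le> j \<Longrightarrow> w_perm n j ?U i = part ?U (j - i + 1) + i"
    using w_perm_properties[of j ?U n] \<open>j \<le> n\<close> by blast+
  then show "tail_increasing n j (varphi n j S)" and "strict_mono_on {1..j} (varphi n j S)"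
    by (simp_all add: varphi_def)
  show "varphi n j S i = n - j - col S i + i" if "1 \<le> i" "i \<le> j" for i
    using *(3)[OF that] part[of "j - i + 1"] that by (simp add: varphi_def)
qed

text \<open>If \<open>(i, j)\<close> is a cell, then \<open>part S i + col S j\<close> is at least
  \<open>i + j\<close>, otherwise at most \<open>i + j - 2\<close>. This says that a vertical and a
  horizontal step of the boundary path never have the same position.\<close>

lemma part_col_disjoint:
  assumes "is_partition S" and "1 \<le> i" and "1 \<le> j"
  shows "part S i + col S j + 1 \<noteq> i + j"
  using assms mem_iff_part[OF assms(1), of i j] mem_iff_col[OF assms(1), of i j] by linarith

lemma w0_apply: "w0 n i = (if 1 \<le> i \<and> i \<le> n then n + 1 - i else i)"
  by (auto simp: w0_def one_line_def dec_block_def rev_nth simp del: upt_Suc)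

lemma bij_betw_w0: "bij_betw (w0 n) {1..n} {1..n}"
  by (rule bij_betw_byWitness[where f' = "w0 n"]) (auto simp: w0_apply)

text \<open>Both functions increase on \<open>1..r\<close> and on \<open>r + 1..n\<close>, so it
  suffices to compare their value sets on \<open>1..r\<close>. The tail of the left side lists the
  positions of the vertical boundary steps of \<open>S\<close>, the first \<open>r\<close> values of
  \<open>varphi\<close> those of the horizontal ones.\<close>

lemma w0_conj_compl:
  assumes S: "is_partition S" "S \<subseteq> rect (m + r) r"
  shows "w0 (m + r) \<circ> w_perm (m + r) m (compl_in (m + r) r S) \<circ> w0 (m + r) = varphi (m + r) r S"
proof -
  let ?n = "m + r" and ?U = "compl_in (m + r) r S"
  define u where "u = w_perm ?n m ?U"
  define f where "f = w0 ?n \<circ> u \<circ> w0 ?n"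
  define g where "g = varphi ?n r S"
  have part: "part ?U i = r - part S (m + 1 - i)" if "1 \<le> i" "i \<le> m" for i
    using part_compl_in[of i ?n r S] that by simp
  have "part ?U k \<le> part ?U i" if "1 \<le> i" "i \<le> k" "k \<le> m" for i k
    using that part_antimono[OF S(1), of "m + 1 - k" "m + 1 - i"] by (simp add: part diff_le_mono2)
  moreover have "part ?U i \<le> ?n - m" if "1 \<le> i" "i \<le> m" for i
    using that by (simp add: part)
  ultimately have u: "tail_increasing ?n m u" "strict_mono_on {1..m} u"
      "\<And>i. 1 \<le> i \<Longrightarrow> i \<le> m \<Longrightarrow> u i = part ?U (m - i + 1) + i"
    unfolding u_def using w_perm_properties[of m ?U ?n] by simp_all
  note g = varphi_properties[OF S(1), of r ?n, folded g_def]
  have ran: "1 \<le> u i \<and> u i \<le> ?n" if "1 \<le> i" "i \<le> ?n" for i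
    using u(1) that by (auto simp: tail_increasing_def bij_betw_def)
  have f_eq: "f i = ?n + 1 - u (?n + 1 - i)" if "1 \<le> i" "i \<le> ?n" for i
    using that ran[of "?n + 1 - i"] by (auto simp: f_def w0_apply)
  have bij: "bij_betw f {1..?n} {1..?n}"
    using u(1) unfolding f_def tail_increasing_def by (blast intro: bij_betw_trans bij_betw_w0)
  have mono1: "strict_mono_on {1..r} f"
  proof (rule strict_mono_onI)
    fix i k assume ik: "i \<in> {1..r}" "k \<in> {1..r}" "i < k"
    then have "u (?n + 1 - k) < u (?n + 1 - i)"
      using u(1) by (intro strict_mono_onD[of "{m<..?n}" u]) (auto simp: tail_increasing_def)
    moreover have "u (?n + 1 - i) \<le> ?n" "f i = ?n + 1 - u (?n + 1 - i)" "f k = ?n + 1 - u (?n + 1 - k)"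
      using ik by (intro conjunct2[OF ran] f_eq; auto)+
    ultimately show "f i < f k"
      by linarith
  qed
  have mono2: "strict_mono_on {r<..?n} f"
  proof (rule strict_mono_onI)
    fix i k assume ik: "i \<in> {r<..?n}" "k \<in> {r<..?n}" "i < k"
    then have "u (?n + 1 - k) < u (?n + 1 - i)"
      using u(2) by (intro strict_mono_onD[of "{1..m}" u]) auto
    moreover have "u (?n + 1 - i) \<le> ?n" "f i = ?n + 1 - u (?n + 1 - i)" "f k = ?n + 1 - u (?n + 1 - k)"
      using ik by (intro conjunct2[OF ran] f_eq; auto)+
    ultimately show "f i < f k"
      by linarith
  qed
  \<comment> \<open>\<open>f (r + a)\<close> equals \<open>part S (m + 1 - a) + a\<close>, the
    position of the vertical step along row \<open>m + 1 - a\<close>.\<close>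
  have disj: "g i \<notin> f ` {r<..?n}" if i: "1 \<le> i" "i \<le> r" for i
  proof
    assume "g i \<in> f ` {r<..?n}"
    then obtain k where k: "r < k" "k \<le> ?n" "g i = f k" by auto
    define a where "a = k - r"
    have a: "1 \<le> a" "a \<le> m" "k = r + a" using k by (auto simp: a_def)
    have "f k = ?n + 1 - (r - part S (m + 1 - a) + (m + 1 - a))"
    proof -
      have "?n + 1 - k = m + 1 - a" "m - (m + 1 - a) + 1 = a" "m + 1 - (m + 1 - a) = a"
        using a by auto
      then have "u (?n + 1 - k) = r - part S (m + 1 - a) + (m + 1 - a)"
        using u(3)[of "m + 1 - a"] part[of a] a by simp
      then show ?thesis
        using f_eq[of k] k by simp
    qed
    moreover have "g i = m - col S i + i"
      using g(2)[OF _ i] by simp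
    ultimately show False
      using part_col_disjoint[OF S(1) _ i(1), of "m + 1 - a"] k(3) a col_le_of_subset_rect[OF S(2), of i]
        part_le_of_subset_rect[OF S(2), of "m + 1 - a"] by linarith
  qed
  have "g ` {1..r} \<subseteq> f ` {1..r}"
  proof
    fix x assume x: "x \<in> g ` {1..r}"
    then have "x \<in> {1..?n}"
      using tail_increasing_range[OF g(1), of r] by auto
    moreover obtain i where "x = g i" "1 \<le> i" "i \<le> r"
      using x by auto
    then have "x \<notin> f ` {r<..?n}"
      using disj by simp
    ultimately show "x \<in> f ` {1..r}"
      using image_tail[OF bij, of r, OF le_add2] by blast
  qed
  moreover have "card (g ` {1..r}) = card (f ` {1..r})"
    using g(3) mono1 by (simp add: card_image strict_mono_on_imp_inj_on)
  ultimately have "g ` {1..r} = f ` {1..r}"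
    by (intro card_subset_eq) auto
  then have "f i = g i" if "1 \<le> i" "i \<le> r" for i
    using that strict_mono_on_same_image[of "{1..r}" f g i] g(3) mono1 by auto
  moreover have "tail_increasing ?n r f"
    using bij mono2 u(1) by (auto simp: tail_increasing_def f_def w0_apply)
  ultimately have "f = g"
    using g(1) by (intro tail_increasing_eqI[of ?n r]) auto
  then show ?thesis
    by (simp add: f_def g_def u_def)
qed

section \<open>Bit strings\<close>

text \<open>The vertical step along row \<open>i\<close> comes after \<open>m - i\<close> vertical
  and \<open>part S i\<close> horizontal steps, which gives the position in the formula. These
  positions avoid the values of \<open>varphi\<close>, and counting shows that nothing else is
  missing.\<close>

lemma varphi_image:
  assumes S: "is_partition S" "S \<subseteq> rect (m + r) r"
  shows "varphi (m + r) r S ` {1..r} = {1..m + r} - (\<lambda>i. part S i + (m + 1 - i)) ` {1..m}"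
proof -
  let ?g = "varphi (m + r) r S" and ?z = "\<lambda>i. part S i + (m + 1 - i)"
  note g = varphi_properties[OF S(1), of r "m + r"]
  have disj: "?g j \<noteq> ?z i" if "1 \<le> i" "i \<le> m" "1 \<le> j" "j \<le> r" for i j
    using part_col_disjoint[OF S(1) that(1,3)] g(2)[OF _ that(3,4)] that
      col_le_of_subset_rect[OF S(2), of j] by linarith
  have sub: "?g ` {1..r} \<subseteq> {1..m + r} - ?z ` {1..m}"
  proof
    fix x assume x: "x \<in> ?g ` {1..r}"
    then obtain j where j: "x = ?g j" "1 \<le> j" "j \<le> r" by auto
    have "x \<notin> ?z ` {1..m}"
    proof
      assume "x \<in> ?z ` {1..m}"
      then obtain i where "x = ?z i" "1 \<le> i" "i \<le> m" by auto
      then show False using disj[of i j] j by simp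
    qed
    moreover have "x \<in> {1..m + r}"
      using x tail_increasing_range[OF g(1), of r] by auto
    ultimately show "x \<in> {1..m + r} - ?z ` {1..m}" by blast
  qed
  have "?z k < ?z i" if "1 \<le> i" "i < k" "k \<le> m" for i k
    using part_antimono[OF S(1), of i k] that by linarith
  then have "inj_on ?z {1..m}"
    by (intro linorder_inj_onI) (metis atLeastAtMost_iff less_irrefl, auto)
  then have cz: "card (?z ` {1..m}) = m"
    by (subst card_image) simp_all
  have "?z i \<in> {1..m + r}" if "i \<in> {1..m}" for i
    using that part_le_of_subset_rect[OF S(2), of i] by auto
  then have "card ({1..m + r} - ?z ` {1..m}) = r"
    using cz by (subst card_Diff_subset) auto
  moreover have "card (?g ` {1..r}) = r"
    using g(3) by (simp add: card_image strict_mono_on_imp_inj_on)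
  ultimately show ?thesis
    using sub by (intro card_subset_eq) auto
qed

lemma bit_string_zeros:
  assumes S: "is_partition S" "S \<subseteq> rect (m + r) r"
  shows "bit_string m r S =
    map (\<lambda>p. if p + 1 \<in> (\<lambda>i. part S i + (m + 1 - i)) ` {1..m} then 0 else 1) [0..<m + r]"
proof -
  define h :: "nat \<Rightarrow> nat" where
    "h = (\<lambda>p. if p + 1 \<in> (\<lambda>i. part S i + (m + 1 - i)) ` {1..m} then 0 else 1)"
  let ?F = "\<lambda>i. replicate (part S i - part S (i + 1)) 1 @ [0::nat]"
  have anti: "part S k \<le> part S i" if "1 \<le> i" "i \<le> k" for i k
    using part_antimono[OF S(1) that] .
  \<comment> \<open>An interval of places that contains no vertical step is a run of ones; places
    are counted from 0 here, hence \<open>m - i\<close>.\<close>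
  have run: "map h [a..<b] = replicate (b - a) 1"
    if "\<And>i. 1 \<le> i \<Longrightarrow> i \<le> m \<Longrightarrow> part S i + (m - i) < a \<or> b \<le> part S i + (m - i)" for a b
  proof -
    have "h p = 1" if p: "p \<in> set [a..<b]" for p
    proof -
      have "p + 1 \<noteq> part S i + (m + 1 - i)" if "1 \<le> i" "i \<le> m" for i
        using \<open>\<And>i. 1 \<le> i \<Longrightarrow> i \<le> m \<Longrightarrow> part S i + (m - i) < a \<or> b \<le> part S i + (m - i)\<close>[OF that] p that
        by auto
      then show ?thesis
        unfolding h_def by fastforce
    qed
    then have "map h [a..<b] = map (\<lambda>_. 1) [a..<b]"
      by (rule map_cong[OF refl])
    then show ?thesis
      by (simp add: map_replicate_const)
  qed
  have "part S (m + 1) = 0"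
    using S(2) by (intro part_unique) (auto simp: rect_def)
  then have top: "part S (Suc m) = 0" by simp
  \<comment> \<open>The induction descends from the top row as the path does; for
    \<open>k < m\<close> the prefix ends just after the vertical step along row
    \<open>k + 1\<close>.\<close>
  have prefix: "concat (map ?F (rev [k + 1..<m + 1])) = map h [0..<part S (k + 1) + (m - k)]"
    if "k \<le> m" for k
    using that
  proof (induction k rule: inc_induct)
    case base
    then show ?case using top by simp
  next
    case (step k)
    \<comment> \<open>Counted from 0, the horizontal steps before the vertical step along row
      \<open>k + 1\<close> occupy the places from \<open>?A\<close> up to, but excluding,
      \<open>?B\<close>; the vertical step is at \<open>?B\<close>.\<close>
    let ?A = "part S (k + 2) + (m - k - 1)" and ?B = "part S (k + 1) + (m - k - 1)"
    have "[k + 1..<m + 1] = (k + 1) # [Suc k + 1..<m + 1]"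
      using step(2) by (simp add: upt_conv_Cons)
    then have "concat (map ?F (rev [k + 1..<m + 1])) = map h [0..<?A] @ ?F (k + 1)"
      using step(3) by (simp del: upt_Suc)
    moreover have "replicate (part S (k + 1) - part S (k + 1 + 1)) 1 = map h [?A..<?B]"
    proof (subst run)
      fix i assume i: "1 \<le> i" "i \<le> m"
      show "part S i + (m - i) < ?A \<or> ?B \<le> part S i + (m - i)"
      proof (cases "i \<le> k + 1")
        case True
        then show ?thesis using anti[of i "k + 1"] i by linarith
      next
        case False
        then show ?thesis using anti[of "k + 2" i] i by linarith
      qed
    qed simp
    moreover have "[0] = map h [?B..<Suc ?B]"
    proof -
      have "?B + 1 = part S (k + 1) + (m + 1 - (k + 1))"
        using step(2) by simp
      then have "h ?B = 0"
        unfolding h_def using step(2) by (auto intro!: image_eqI[of _ _ "k + 1"])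
      then show ?thesis by simp
    qed
    moreover have "map h [0..<?A] @ map h [?A..<?B] @ map h [?B..<Suc ?B] = map h [0..<Suc ?B]"
    proof -
      have "?A \<le> ?B"
        using anti[of "k + 1" "k + 2"] by simp
      then have "[0..<Suc ?B] = [0..<?A] @ [?A..<?B] @ [?B..<Suc ?B]"
        using upt_add_eq_append[of 0 ?A "?B - ?A"] by (simp add: add.commute)
      then show ?thesis by (simp only: map_append)
    qed
    moreover have "part S (k + 1) + (m - k) = Suc ?B"
      using step(2) by simp
    ultimately show ?case
      by (simp only:)
  qed
  have "bit_string m r S = map h [0..<part S 1 + m] @ replicate (r - part S 1) 1"
    using prefix[of 0] by (simp add: bit_string_def del: upt_Suc)
  also have "replicate (r - part S 1) 1 = map h [part S 1 + m..<m + r]"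
  proof (subst run)
    fix i assume i: "1 \<le> i" "i \<le> m"
    then show "part S i + (m - i) < part S 1 + m \<or> m + r \<le> part S i + (m - i)"
      using anti[of 1 i] by linarith
  qed simp
  also have "map h [0..<part S 1 + m] @ map h [part S 1 + m..<m + r] = map h [0..<m + r]"
  proof -
    have "[0..<m + r] = [0..<part S 1 + m] @ [part S 1 + m..<m + r]"
      using part_le_of_subset_rect[OF S(2), of 1] upt_add_eq_append[of 0 "part S 1 + m" "r - part S 1"]
      by (simp add: add.commute)
    then show ?thesis by (simp only: map_append)
  qed
  finally show ?thesis
    unfolding h_def .
qed

lemma bit_string_ones:
  assumes S: "is_partition S" "S \<subseteq> rect (m + r) r"
  shows "bit_string m r S =
    map (\<lambda>p. if p + 1 \<in> varphi (m + r) r S ` {1..r} then 1 else 0) [0..<m + r]"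
proof -
  define Z where "Z = (\<lambda>i. part S i + (m + 1 - i)) ` {1..m}"
  show ?thesis
    unfolding bit_string_zeros[OF S] varphi_image[OF S] Z_def[symmetric] by simp
qed

lemma shape_of_col_rect:
  assumes "is_partition S" and "S \<subseteq> rect (m + r) r"
  shows "shape_of r (col S) = S"
  by (rule shape_of_col[OF assms(1)]) (use assms(2) in \<open>auto simp: rect_def\<close>)

lemma bit_string_inject:
  assumes S: "is_partition S" "S \<subseteq> rect (m + r) r" and T: "is_partition T" "T \<subseteq> rect (m + r) r"
    and eq: "bit_string m r S = bit_string m r T"
  shows "S = T"
proof -
  let ?f = "varphi (m + r) r S" and ?g = "varphi (m + r) r T"
  note f = varphi_properties[OF S(1), of r "m + r"] and g = varphi_properties[OF T(1), of r "m + r"]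
  have ran: "?f ` {1..r} \<subseteq> {1..m + r}" "?g ` {1..r} \<subseteq> {1..m + r}"
    using tail_increasing_range[OF f(1), of r] tail_increasing_range[OF g(1), of r] by simp_all
  have im: "?f ` {1..r} = ?g ` {1..r}"
  proof -
    define A B where "A = ?f ` {1..r}" and "B = ?g ` {1..r}"
    have bits: "(if p + 1 \<in> A then 1 else 0 :: nat) = (if p + 1 \<in> B then 1 else 0)" if "p < m + r" for p
      using arg_cong[OF eq, of "\<lambda>xs. xs ! p"] that
      unfolding bit_string_ones[OF S] bit_string_ones[OF T] A_def[symmetric] B_def[symmetric] by simp
    have "x \<in> A \<longleftrightarrow> x \<in> B" if "x \<in> {1..m + r}" for x
    proof -
      have "x - 1 < m + r" "x - 1 + 1 = x"
        using that by auto
      then show ?thesis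
        using bits[of "x - 1"] by (metis zero_neq_one)
    qed
    then show ?thesis
      using ran unfolding A_def[symmetric] B_def[symmetric] by blast
  qed
  have "col S j = col T j" if j: "1 \<le> j" "j \<le> r" for j
  proof -
    have "?f j = ?g j"
      using strict_mono_on_same_image[of "{1..r}" ?f ?g j] f(3) g(3) im j by simp
    then have "m - col S j = m - col T j"
      using f(2)[OF _ j] g(2)[OF _ j] by simp
    then show ?thesis
      using col_le_of_subset_rect[OF S(2), of j] col_le_of_subset_rect[OF T(2), of j] by linarith
  qed
  then have "shape_of r (col S) = shape_of r (col T)"
    by (auto simp: shape_of_def)
  moreover have "shape_of r (col S) = S" "shape_of r (col T) = T"
    by (rule shape_of_col_rect[OF S] shape_of_col_rect[OF T])+
  ultimately show ?thesis by simp
qed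

text \<open>Rotating by \<open>a\<close> puts bit \<open>(a + p) mod (m + r)\<close> at place
  \<open>p\<close>, and injectivity of the bit string makes the description in
  \<open>phi_rot\<close> unique.\<close>

lemma phi_rot_eqI:
  assumes S: "is_partition S" "S \<subseteq> rect (m + r) r" and T: "is_partition T" "T \<subseteq> rect (m + r) r"
    and ones: "\<And>p. p < m + r \<Longrightarrow> p + 1 \<in> varphi (m + r) r T ` {1..r} \<longleftrightarrow>
      (a + p) mod (m + r) + 1 \<in> varphi (m + r) r S ` {1..r}"
  shows "phi_rot m r a S = T"
proof -
  have "bit_string m r T = rotate a (bit_string m r S)"
    unfolding bit_string_ones[OF S] bit_string_ones[OF T]
  proof (rule nth_equalityI)
    fix p assume "p < length (map (\<lambda>p. if p + 1 \<in> varphi (m + r) r T ` {1..r} then 1 else 0 :: nat) [0..<m + r])"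
    then have "p < m + r" by simp
    moreover from this have "(a + p) mod (m + r) < m + r"
      by (intro mod_less_divisor) linarith
    ultimately show "map (\<lambda>p. if p + 1 \<in> varphi (m + r) r T ` {1..r} then 1 else 0) [0..<m + r] ! p =
        rotate a (map (\<lambda>p. if p + 1 \<in> varphi (m + r) r S ` {1..r} then 1 else 0) [0..<m + r]) ! p"
      using ones[of p] by (simp add: nth_rotate)
  qed simp
  with T show ?thesis
    unfolding phi_rot_def by (intro the_equality) (metis bit_string_inject)+
qed

section \<open>Column residues modulo n\<close>

definition residues :: "nat \<Rightarrow> nat \<Rightarrow> (nat \<Rightarrow> nat) \<Rightarrow> int set" where
  "residues m r c = (\<lambda>i. (2 * int m - int (c i) + int i) mod int (m + r)) ` {1..r}"

text \<open>From column 2 on the raise by 1 cancels against the shift of the index; in column 1 the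
  wrap-around changes the number by exactly \<open>m + r\<close>. Integers avoid truncation when
  \<open>c i\<close> exceeds \<open>2 * m\<close>.\<close>

lemma residues_add_hook:
  assumes "1 \<le> r"
  shows "residues m r (add_hook m r c) = residues m r c"
proof -
  let ?q = "\<lambda>c i. (2 * int m - int (c i) + int i) mod int (m + r)"
  have first: "?q (add_hook m r c) 1 = ?q c r"
  proof -
    have "2 * int m - int (c r) + int r = (2 * int m - int (add_hook m r c 1) + int 1) + int (m + r)"
      by (simp add: add_hook_def)
    then show ?thesis by (metis mod_add_self2)
  qed
  have next_col: "?q (add_hook m r c) (Suc j) = ?q c j" if "1 \<le> j" for j
    using that by (simp add: add_hook_def algebra_simps)
  have "?q (add_hook m r c) i \<in> ?q c ` {1..r}" if "i \<in> {1..r}" for i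
  proof (cases "i = 1")
    case True
    then show ?thesis
      using first assms by (intro image_eqI[of _ _ r]) auto
  next
    case False
    then show ?thesis
      using next_col[of "i - 1"] that by (intro image_eqI[of _ _ "i - 1"]) auto
  qed
  moreover have "?q c i \<in> ?q (add_hook m r c) ` {1..r}" if "i \<in> {1..r}" for i
  proof (cases "i = r")
    case True
    then show ?thesis
      using first assms by (intro image_eqI[of _ _ 1]) auto
  next
    case False
    then show ?thesis
      using next_col[of i] that by (intro image_eqI[of _ _ "Suc i"]) auto
  qed
  ultimately show ?thesis
    unfolding residues_def by blast
qed

lemma residues_funpow:
  assumes "1 \<le> r \<or> d = 0"
  shows "residues m r ((add_hook m r ^^ d) c) = residues m r c"
  using assms
proof (induction d)
  case (Suc d)
  then show ?case
    using residues_add_hook[of r m "(add_hook m r ^^ d) c"] by simp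
qed simp

section \<open>Block exchanges\<close>

lemma length_dec_block [simp]: "length (dec_block a b) = b - a"
  by (simp add: dec_block_def del: upt_Suc)

lemma nth_dec_block [simp]: "k < b - a \<Longrightarrow> dec_block a b ! k = b - k"
  by (simp add: dec_block_def rev_nth del: upt_Suc)

lemma w0P_apply:
  assumes "m \<le> n"
  shows "w0P m n i = (if 1 \<le> i \<and> i \<le> m then m + 1 - i else if m < i \<and> i \<le> n then n + m + 1 - i else i)"
  using assms by (auto simp: w0P_def one_line_def nth_append)

lemma w0P'_apply:
  assumes "t \<le> m" and "m + t \<le> n"
  shows "w0P' m n t i =
    (if 1 \<le> i \<and> i \<le> m - t then m - t + 1 - i
     else if m - t < i \<and> i \<le> m then 2 * m - t + 1 - i
     else if m < i \<and> i \<le> m + t then 2 * m + t + 1 - i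
     else if m + t < i \<and> i \<le> n then n + m + t + 1 - i else i)"
  using assms by (auto simp: w0P'_def one_line_def nth_append)

text \<open>With \<open>n = m + r\<close>, the one-line notation is
  \<open>[t+1 .. r | 1 .. t | n-t+1 .. n | r+1 .. n-t]\<close>.\<close>

definition block_swap :: "nat \<Rightarrow> nat \<Rightarrow> nat \<Rightarrow> perm" where
  "block_swap m r t i =
    (if i = 0 then 0
     else if i \<le> r - t then i + t
     else if i \<le> r then i - (r - t)
     else if i \<le> r + t then i + (m - t)
     else if i \<le> m + r then i - t else i)"

text \<open>Each of the four factors reverses blocks; since their number is even, the product is a
  translation on each of the four blocks.\<close>

lemma block_swap_eq:
  assumes "t \<le> m" and "t \<le> r"
  shows "w0 (m + r) \<circ> w0P m (m + r) \<circ> w0P' m (m + r) t \<circ> w0 (m + r) = block_swap m r t"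
proof
  fix i
  \<comment> \<open>Writing \<open>m\<close> and \<open>r\<close> as sums removes the truncated
    differences \<open>m - t\<close> and \<open>r - t\<close>.\<close>
  obtain a b where ab: "m = a + t" "r = b + t"
    using assms by (metis add.commute le_Suc_ex)
  let ?n = "m + r"
  have chain: "(w0 ?n \<circ> w0P m ?n \<circ> w0P' m ?n t \<circ> w0 ?n) i = x4"
    if "w0 ?n i = x1" "w0P' m ?n t x1 = x2" "w0P m ?n x2 = x3" "w0 ?n x3 = x4" for x1 x2 x3 x4
    using that by simp
  consider "i = 0 \<or> ?n < i" | "1 \<le> i" "i \<le> b" | "b < i" "i \<le> r" | "r < i" "i \<le> r + t"
    | "r + t < i" "i \<le> ?n"
    using ab by linarith
  then show "(w0 ?n \<circ> w0P m ?n \<circ> w0P' m ?n t \<circ> w0 ?n) i = block_swap m r t i"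
  proof cases
    case 1
    have "w0 ?n i = i" "w0P' m ?n t i = i" "w0P m ?n i = i" "block_swap m r t i = i"
      using 1 ab by (auto simp: w0_apply w0P_apply w0P'_apply block_swap_def)
    then show ?thesis by simp
  next
    case 2
    have "block_swap m r t i = i + t"
      using 2 ab by (simp add: block_swap_def)
    moreover have "w0 ?n i = ?n + 1 - i" "w0P m ?n (m + t + i) = ?n + 1 - t - i" "w0 ?n (?n + 1 - t - i) = i + t"
      using 2 ab by (auto simp: w0_apply w0P_apply)
    moreover have "w0P' m ?n t (?n + 1 - i) = m + t + i"
      using 2 ab by (auto simp: w0P'_apply)
    ultimately show ?thesis
      using chain by metis
  next
    case 3
    define j where "j = i - b"
    have j: "i = b + j" "1 \<le> j" "j \<le> t"
      using 3 ab by (auto simp: j_def)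
    have "block_swap m r t i = j"
      using j ab by (simp add: block_swap_def)
    moreover have "w0 ?n i = a + 2 * t + 1 - j" "w0P m ?n (m + j) = ?n + 1 - j" "w0 ?n (?n + 1 - j) = j"
      using j ab by (auto simp: w0_apply w0P_apply)
    moreover have "w0P' m ?n t (a + 2 * t + 1 - j) = m + j"
      using j ab by (auto simp: w0P'_apply)
    ultimately show ?thesis
      using chain by metis
  next
    case 4
    define j where "j = i - r"
    have j: "i = r + j" "1 \<le> j" "j \<le> t"
      using 4 ab by (auto simp: j_def)
    have "block_swap m r t i = a + r + j"
      using j ab by (simp add: block_swap_def)
    moreover have "w0 ?n i = m + 1 - j" "w0P m ?n (a + j) = t + 1 - j" "w0 ?n (t + 1 - j) = a + r + j"
      using j ab by (auto simp: w0_apply w0P_apply)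
    moreover have "w0P' m ?n t (m + 1 - j) = a + j"
      using j ab by (auto simp: w0P'_apply)
    ultimately show ?thesis
      using chain by metis
  next
    case 5
    define j where "j = i - (r + t)"
    have j: "i = r + t + j" "1 \<le> j" "j \<le> a"
      using 5 ab by (auto simp: j_def)
    have "block_swap m r t i = r + j"
      using j ab by (simp add: block_swap_def)
    moreover have "w0 ?n i = a + 1 - j" "w0P m ?n j = m + 1 - j" "w0 ?n (m + 1 - j) = r + j"
      using j ab by (auto simp: w0_apply w0P_apply)
    moreover have "w0P' m ?n t (a + 1 - j) = j"
      using j ab by (auto simp: w0P'_apply)
    ultimately show ?thesis
      using chain by metis
  qed
qed

definition block_unswap :: "nat \<Rightarrow> nat \<Rightarrow> nat \<Rightarrow> perm" where
  "block_unswap m r t i =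
    (if i = 0 then 0
     else if i \<le> t then i + (r - t)
     else if i \<le> r then i - t
     else if i \<le> m + r - t then i + t
     else if i \<le> m + r then i - (m - t) else i)"

lemma block_unswap_swap:
  assumes "t \<le> m" and "t \<le> r"
  shows "block_unswap m r t (block_swap m r t i) = i" and "block_swap m r t (block_unswap m r t i) = i"
  using assms by (auto simp: block_swap_def block_unswap_def)

lemma bij_betw_block_unswap:
  assumes "t \<le> m" and "t \<le> r"
  shows "bij_betw (block_unswap m r t) {1..m + r} {1..m + r}"
  by (rule bij_betw_byWitness[where f' = "block_swap m r t"])
    (use assms in \<open>auto simp: block_unswap_swap\<close>, auto simp: block_swap_def block_unswap_def)

section \<open>The rotated partition\<close>

text \<open>The last \<open>s\<close> columns move to the front. The vertical shifts are chosen so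
  that \<open>m - e i + i\<close>, for the new heights \<open>e\<close>, agrees with the residue
  number \<open>2 * m - c j + j\<close> of the old column, up to subtracting \<open>m + r\<close>
  for the moved columns.\<close>

definition rotated_columns :: "nat \<Rightarrow> nat \<Rightarrow> nat \<Rightarrow> (nat \<Rightarrow> nat) \<Rightarrow> nat \<Rightarrow> nat" where
  "rotated_columns m r s c i = (if i \<le> s then c (r - s + i) + s else c (i - s) + s - m)"

lemma rotated_columns_bounds:
  assumes c: "cyclic_columns m r c" and gap: "diag_gap m r c s" and top: "c 1 \<le> 2 * m"
  shows "antimono_on {1..r} (rotated_columns m r s c)"
    and "\<And>i. 1 \<le> i \<Longrightarrow> i \<le> r \<Longrightarrow> rotated_columns m r s c i \<le> m"
    and "\<And>i. s < i \<Longrightarrow> i \<le> r \<Longrightarrow> m \<le> c (i - s) + s"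
proof -
  have mono: "c j \<le> c i" if "1 \<le> i" "i \<le> j" "j \<le> r" for i j
    using c that by (auto simp: cyclic_columns_def intro: antimono_on_intervalD)
  have cyc: "c 1 \<le> c r + m" using c by (simp add: cyclic_columns_def)
  have s: "s \<le> r" using gap by (simp add: diag_gap_def)
  show low: "m \<le> c (i - s) + s" if "s < i" "i \<le> r" for i
  proof -
    have "c (r - s) \<le> c (i - s)"
      using that by (intro mono) auto
    then show ?thesis
      using gap that by (simp add: diag_gap_def)
  qed
  have near: "c (r - s + i) + s \<le> m" if "1 \<le> i" "i \<le> s" for i
  proof -
    have "c (r - s + i) \<le> c (r + 1 - s)"
      using that s by (intro mono) auto
    then show ?thesis
      using gap that by (simp add: diag_gap_def)
  qed
  \<comment> \<open>For \<open>s = 0\<close> this is the height bound; otherwise \<open>c 1\<close>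
    is at most \<open>c r + m\<close>, and \<open>near\<close> at \<open>s\<close> bounds
    \<open>c r + s\<close> by \<open>m\<close>.\<close>
  have far: "c (i - s) + s \<le> 2 * m" if "s < i" "i \<le> r" for i
  proof -
    have "c (i - s) \<le> c 1"
      using that by (intro mono) auto
    then show ?thesis
      using top cyc near[of s] s by (cases "s = 0") auto
  qed
  have "rotated_columns m r s c k \<le> rotated_columns m r s c i" if "1 \<le> i" "i \<le> k" "k \<le> r" for i k
  proof -
    consider "k \<le> s" | "i \<le> s" "s < k" | "s < i" by linarith
    then show ?thesis
    proof cases
      case 1
      then show ?thesis
        using that s mono[of "r - s + i" "r - s + k"] by (simp add: rotated_columns_def)
    next
      case 2
      \<comment> \<open>Where the two groups of columns meet, the cyclic inequality between
        \<open>c 1\<close> and \<open>c r\<close> supplies the monotonicity.\<close>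
      have "c (k - s) \<le> c 1" "c r \<le> c (r - s + i)"
        using that 2 s by (intro mono; simp)+
      then show ?thesis
        using 2 cyc by (simp add: rotated_columns_def)
    next
      case 3
      have "c (k - s) \<le> c (i - s)"
        using that 3 by (intro mono) auto
      then show ?thesis
        using that 3 by (simp add: rotated_columns_def)
    qed
  qed
  then show "antimono_on {1..r} (rotated_columns m r s c)"
    by (intro monotone_onI) auto
  show "rotated_columns m r s c i \<le> m" if "1 \<le> i" "i \<le> r" for i
    using near[of i] far[of i] that by (auto simp: rotated_columns_def)
qed

lemma mod_inj_on_segment:
  assumes "x \<in> {1..n}" and "y \<in> {1..n}" and "int x mod int n = int y mod int n"
  shows "x = y"
proof -
  have "x mod n = y mod n"
    using assms(3) by (metis nat_int_comparison(1) zmod_int)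
  then show ?thesis
    using assms(1,2) by (cases "x = n"; cases "y = n") auto
qed

lemma shape_of_rect:
  assumes "\<And>j. 1 \<le> j \<Longrightarrow> j \<le> r \<Longrightarrow> c j \<le> m"
  shows "shape_of r c \<subseteq> rect (m + r) r"
  using assms by (auto simp: rect_def) (meson One_nat_def order_trans)

lemma tail_increasing_apply: "tail_increasing n j f \<Longrightarrow> i \<in> {1..n} \<Longrightarrow> f i \<in> {1..n}"
  unfolding tail_increasing_def by (meson bij_betw_apply)

text \<open>The residues of \<open>c\<close> are those of the values \<open>g i\<close> for the
  rotated columns, and the residues of \<open>nu\<close> are those of the values \<open>f j\<close>
  shifted by \<open>m\<close>. As \<open>m + r = n\<close>, rotation by \<open>r\<close> undoes this
  shift, so the ones of the two bit strings correspond.\<close>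

lemma phi_rot_columns:
  assumes nu: "is_partition nu" "nu \<subseteq> rect (m + r) r"
    and c: "cyclic_columns m r c" and gap: "diag_gap m r c s" and top: "c 1 \<le> 2 * m"
    and res: "residues m r c = residues m r (col nu)"
  shows "phi_rot m r r nu = shape_of r (rotated_columns m r s c)"
proof (rule phi_rot_eqI[OF nu])
  let ?e = "rotated_columns m r s c" and ?n = "m + r"
  let ?rho = "shape_of r ?e"
  note e = rotated_columns_bounds[OF c gap top]
  have s: "s \<le> r"
    using gap by (simp add: diag_gap_def)
  show rho: "is_partition ?rho"
    using e(1) by (rule is_partition_shape_of)
  show "?rho \<subseteq> rect ?n r"
    using e(2) by (rule shape_of_rect)
  define f g where "f = varphi ?n r nu" and "g = varphi ?n r ?rho"
  have f: "tail_increasing ?n r f" "\<And>i. 1 \<le> i \<Longrightarrow> i \<le> r \<Longrightarrow> f i = m - col nu i + i"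
    using varphi_properties[OF nu(1), of r ?n] by (simp_all add: f_def)
  have g: "tail_increasing ?n r g" "\<And>i. 1 \<le> i \<Longrightarrow> i \<le> r \<Longrightarrow> g i = m - ?e i + i"
    using varphi_properties[OF rho, of r ?n] by (simp_all add: g_def col_shape_of)
  have f_range: "f i \<in> {1..?n}" and g_range: "g i \<in> {1..?n}" if "i \<in> {1..r}" for i
    using tail_increasing_apply[OF f(1), of i] tail_increasing_apply[OF g(1), of i] that by auto
  define q where "q c i = 2 * int m - int (c i) + int i" for c :: "nat \<Rightarrow> nat" and i
  \<comment> \<open>Column \<open>i\<close> of the rotated shape comes from column
    \<open>sig i\<close> of \<open>c\<close>.\<close>
  define sig where "sig i = (if i \<le> s then r - s + i else i - s)" for i
  have sig: "sig ` {1..r} = {1..r}"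
  proof
    show "sig ` {1..r} \<subseteq> {1..r}"
      using s by (auto simp: sig_def)
    show "{1..r} \<subseteq> sig ` {1..r}"
    proof
      fix j assume j: "j \<in> {1..r}"
      show "j \<in> sig ` {1..r}"
      proof (cases "j \<le> r - s")
        case True
        then show ?thesis
          using j s by (intro image_eqI[of _ _ "j + s"]) (auto simp: sig_def)
      next
        case False
        then show ?thesis
          using j s by (intro image_eqI[of _ _ "j - (r - s)"]) (auto simp: sig_def)
      qed
    qed
  qed
  have "int (g i) mod int ?n = q c (sig i) mod int ?n" if i: "1 \<le> i" "i \<le> r" for i
  proof (cases "i \<le> s")
    case True
    then have "c (r - s + i) + s \<le> m"
      using e(2)[OF i] by (simp add: rotated_columns_def)
    then have "int (g i) + int ?n = q c (sig i)"
      using g(2)[OF i] True s by (simp add: rotated_columns_def q_def sig_def)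
    then show ?thesis
      by (metis mod_add_self2)
  next
    case False
    then have "c (i - s) + s - m \<le> m" "m \<le> c (i - s) + s"
      using e(2)[OF i] e(3)[of i] i by (simp_all add: rotated_columns_def)
    then have "int (g i) = q c (sig i)"
      using g(2)[OF i] False by (simp add: rotated_columns_def q_def sig_def)
    then show ?thesis by simp
  qed
  then have "(\<lambda>i. int (g i) mod int ?n) ` {1..r} = (\<lambda>i. q c i mod int ?n) ` sig ` {1..r}"
    unfolding image_image by (intro image_cong) auto
  then have res_g: "residues m r c = (\<lambda>i. int (g i) mod int ?n) ` {1..r}"
    unfolding sig by (simp add: residues_def q_def)
  have q_f: "q (col nu) j = int m + int (f j)" if "1 \<le> j" "j \<le> r" for j
    using f(2)[OF that] col_le_of_subset_rect[OF nu(2), of j] by (simp add: q_def)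
  fix p assume p: "p < ?n"
  then have pos: "0 < ?n" by linarith
  \<comment> \<open>The two congruences differ by adding \<open>r\<close> to both sides, and
    \<open>m + r\<close> vanishes modulo \<open>n\<close>.\<close>
  have shift: "int (p + 1) mod int ?n = (int m + int y) mod int ?n \<longleftrightarrow>
      int ((r + p) mod ?n + 1) mod int ?n = int y mod int ?n" for y
  proof -
    have "int ((r + p) mod ?n + 1) mod int ?n = (int p + 1 + int r) mod int ?n"
      by (simp add: zmod_int mod_simps ac_simps)
    moreover have "(int p + 1) - (int m + int y) + int ?n = (int p + 1 + int r) - int y"
      by simp
    moreover have "int (p + 1) mod int ?n = (int m + int y) mod int ?n \<longleftrightarrow>
        int ?n dvd (int p + 1) - (int m + int y) + int ?n"
      unfolding mod_eq_dvd_iff dvd_add_triv_right_iff by (simp only: of_nat_add of_nat_1)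
    moreover have "(int p + 1 + int r) mod int ?n = int y mod int ?n \<longleftrightarrow>
        int ?n dvd (int p + 1 + int r) - int y"
      by (rule mod_eq_dvd_iff)
    ultimately show ?thesis
      by (simp only:)
  qed
  have "p + 1 \<in> g ` {1..r} \<longleftrightarrow> int (p + 1) mod int ?n \<in> residues m r c"
  proof
    assume "p + 1 \<in> g ` {1..r}"
    then obtain i where "i \<in> {1..r}" "p + 1 = g i" by blast
    then show "int (p + 1) mod int ?n \<in> residues m r c"
      unfolding res_g by simp
  next
    assume "int (p + 1) mod int ?n \<in> residues m r c"
    then obtain i where i: "i \<in> {1..r}" "int (p + 1) mod int ?n = int (g i) mod int ?n"
      unfolding res_g by blast
    then have "p + 1 = g i"
      using mod_inj_on_segment[OF _ g_range[OF i(1)], of "p + 1"] p by simp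
    then show "p + 1 \<in> g ` {1..r}"
      using i(1) by blast
  qed
  also have "\<dots> \<longleftrightarrow> (\<exists>j\<in>{1..r}. int (p + 1) mod int ?n = (int m + int (f j)) mod int ?n)"
  proof -
    have "residues m r (col nu) = (\<lambda>j. (int m + int (f j)) mod int ?n) ` {1..r}"
      unfolding residues_def q_def[symmetric] by (intro image_cong) (auto simp: q_f)
    then show ?thesis
      unfolding res by auto
  qed
  also have "\<dots> \<longleftrightarrow> (\<exists>j\<in>{1..r}. int ((r + p) mod ?n + 1) mod int ?n = int (f j) mod int ?n)"
    unfolding shift ..
  also have "\<dots> \<longleftrightarrow> (r + p) mod ?n + 1 \<in> f ` {1..r}"
  proof
    assume "\<exists>j\<in>{1..r}. int ((r + p) mod ?n + 1) mod int ?n = int (f j) mod int ?n"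
    then obtain j where j: "j \<in> {1..r}" "int ((r + p) mod ?n + 1) mod int ?n = int (f j) mod int ?n"
      by blast
    have "(r + p) mod ?n + 1 \<in> {1..?n}"
      using mod_less_divisor[OF pos, of "r + p"] by simp
    then have "(r + p) mod ?n + 1 = f j"
      using mod_inj_on_segment[OF _ f_range[OF j(1)]] j(2) by blast
    then show "(r + p) mod ?n + 1 \<in> f ` {1..r}"
      using j(1) by blast
  next
    assume "(r + p) mod ?n + 1 \<in> f ` {1..r}"
    then obtain j where "j \<in> {1..r}" "(r + p) mod ?n + 1 = f j" by blast
    then show "\<exists>j\<in>{1..r}. int ((r + p) mod ?n + 1) mod int ?n = int (f j) mod int ?n"
      by (intro bexI[of _ j]) simp_all
  qed
  finally show "p + 1 \<in> varphi ?n r ?rho ` {1..r} \<longleftrightarrow> (r + p) mod ?n + 1 \<in> varphi ?n r nu ` {1..r}"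
    unfolding f_def g_def .
qed

section \<open>The product of permutations\<close>

lemma tail_increasing_lower_bound:
  assumes "tail_increasing n j v" and "1 \<le> k" and "j + k \<le> n"
  shows "k \<le> v (j + k)"
  using assms(2,3)
proof (induction k rule: nat_induct_at_least)
  case base
  have "v (j + 1) \<in> {1..n}"
    using base by (intro tail_increasing_apply[OF assms(1)]) simp
  then show ?case by simp
next
  case (Suc k)
  have "v (j + k) < v (j + Suc k)"
    using assms(1) Suc by (intro strict_mono_onD[of "{j<..n}" v]) (auto simp: tail_increasing_def)
  then show ?case using Suc by simp
qed

text \<open>The value \<open>b\<close> has to occur in the tail, say at \<open>j + k\<close>. The
  lower bound gives \<open>k\<close> at most \<open>b\<close>, and \<open>k < b\<close> is
  impossible because by induction that place holds \<open>k\<close>.\<close>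

lemma tail_increasing_initial:
  assumes v: "tail_increasing n j v" and "j \<le> n"
    and avoid: "\<And>k. 1 \<le> k \<Longrightarrow> k \<le> j \<Longrightarrow> a < v k" and "1 \<le> b" and "b \<le> a" and "a \<le> n"
  shows "v (j + b) = b"
  using assms(4,5)
proof (induction b rule: less_induct)
  case (less b)
  have "b \<in> {1..n} - v ` {1..j}"
    using less.prems \<open>a \<le> n\<close> avoid by fastforce
  then have "b \<in> v ` {j<..n}"
    using image_tail[of v n j] v \<open>j \<le> n\<close> by (simp add: tail_increasing_def)
  then obtain l where l: "j < l" "l \<le> n" "b = v l" by auto
  define k where "k = l - j"
  have k: "1 \<le> k" "l = j + k" using l by (auto simp: k_def)
  have "k \<le> b"
    using tail_increasing_lower_bound[OF v k(1)] l k by simp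
  moreover have "\<not> k < b"
    using less.IH[of k] k l less.prems by auto
  ultimately show ?case
    using l k by simp
qed

text \<open>At height \<open>m - s\<close> the first \<open>r - s\<close> columns are full below the
  cut and the last \<open>s\<close> columns are empty above it. Hence \<open>x\<close> fixes
  \<open>1..r - s\<close>, and \<open>v\<close> takes there the values of \<open>g\<close> on
  \<open>s + 1..r\<close>; the smaller values of \<open>g\<close> are found in the tail of
  \<open>v\<close>.\<close>

lemma composite_eq:
  assumes c: "cyclic_columns m r c" and gap: "diag_gap m r c s" and top: "c 1 \<le> 2 * m"
    and s: "s \<le> m" "s \<le> r"
  shows "varphi (m + r) (r - s) (upper_rows (m - s) (shape_of r c)) \<circ>
      varphi (m + r) (r + s) (bottom_rows (m - s) (shape_of r c)) =
    varphi (m + r) r (shape_of r (rotated_columns m r s c)) \<circ> block_swap m r s"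
proof -
  let ?n = "m + r" and ?e = "rotated_columns m r s c"
  \<comment> \<open>\<open>varphi\<close> with index \<open>r + s\<close> reads \<open>s\<close>
    columns beyond the shape; their height is 0.\<close>
  define lo where "lo j = (if j \<le> r then min (c j) (m - s) else 0)" for j
  define hi where "hi j = c j - (m - s)" for j
  have mono: "c j \<le> c i" if "1 \<le> i" "i \<le> j" "j \<le> r" for i j
    using c that by (auto simp: cyclic_columns_def intro: antimono_on_intervalD)
  have eta1: "bottom_rows (m - s) (shape_of r c) = shape_of (r + s) lo"
    by (auto simp: bottom_rows_def lo_def split: if_splits)
  have eta2: "upper_rows (m - s) (shape_of r c) = shape_of r hi"
    by (auto simp: upper_rows_def hi_def)
  have part1: "is_partition (shape_of (r + s) lo)"
  proof (rule is_partition_shape_of, rule monotone_onI)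
    fix i j assume "i \<in> {1..r + s}" "j \<in> {1..r + s}" "i \<le> j"
    then show "lo j \<le> lo i"
      using mono[of i j] by (auto simp: lo_def)
  qed
  have part2: "is_partition (shape_of r hi)"
  proof (rule is_partition_shape_of, rule monotone_onI)
    fix i j assume "i \<in> {1..r}" "j \<in> {1..r}" "i \<le> j"
    then show "hi j \<le> hi i"
      using mono[of i j] by (auto simp: hi_def)
  qed
  note e = rotated_columns_bounds[OF c gap top]
  define x v g where "x = varphi ?n (r + s) (shape_of (r + s) lo)"
    and "v = varphi ?n (r - s) (shape_of r hi)" and "g = varphi ?n r (shape_of r ?e)"
  have x: "tail_increasing ?n (r + s) x" "\<And>i. 1 \<le> i \<Longrightarrow> i \<le> r + s \<Longrightarrow> x i = m - s - lo i + i"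
    using varphi_properties[OF part1, of "r + s" ?n] s by (simp_all add: x_def col_shape_of)
  have v: "tail_increasing ?n (r - s) v" "\<And>i. 1 \<le> i \<Longrightarrow> i \<le> r - s \<Longrightarrow> v i = m + s - hi i + i"
    using varphi_properties[OF part2, of "r - s" ?n] s by (simp_all add: v_def col_shape_of)
  have g: "tail_increasing ?n r g" "\<And>i. 1 \<le> i \<Longrightarrow> i \<le> r \<Longrightarrow> g i = m - ?e i + i"
      "strict_mono_on {1..r} g"
    using varphi_properties[OF is_partition_shape_of[OF e(1)], of r ?n]
    by (simp_all add: g_def col_shape_of)
  have g_near: "g i = m - (c (r - s + i) + s) + i" "c (r - s + i) + s \<le> m" if "1 \<le> i" "i \<le> s" for i
    using g(2)[of i] e(2)[of i] that s by (simp_all add: rotated_columns_def)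
  have g_far: "g (i + s) = 2 * m - c i + i" "m \<le> c i + s" "c i \<le> 2 * m" if "1 \<le> i" "i \<le> r - s" for i
  proof -
    show "m \<le> c i + s" using e(3)[of "i + s"] that by simp
    moreover have "c i \<le> c 1" using that by (intro mono) auto
    then show "c i \<le> 2 * m" using top by simp
    moreover have "c i + s - m \<le> m"
      using e(2)[of "i + s"] that by (simp add: rotated_columns_def)
    ultimately show "g (i + s) = 2 * m - c i + i"
      using g(2)[of "i + s"] that by (simp add: rotated_columns_def)
  qed
  have x_far: "x i = i" if "1 \<le> i" "i \<le> r - s" for i
  proof -
    have "lo i = m - s"
      using g_far(2)[OF that] that by (auto simp: lo_def)
    then show ?thesis
      using x(2)[of i] that by simp
  qed
  have x_near: "x (r - s + i) = r - s + g i" if "1 \<le> i" "i \<le> s" for i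
  proof -
    have "lo (r - s + i) = c (r - s + i)"
      using g_near(2)[OF that] that s by (auto simp: lo_def)
    then show ?thesis
      using x(2)[of "r - s + i"] g_near[OF that] that s by simp
  qed
  \<comment> \<open>The empty columns \<open>r + 1\<close> to \<open>r + s\<close> give the
    \<open>s\<close> largest values.\<close>
  have x_top: "x (i - (m - s)) = i" if "?n - s < i" "i \<le> ?n" for i
  proof -
    have "lo (i - (m - s)) = 0"
      using that s by (auto simp: lo_def)
    moreover have "1 \<le> i - (m - s)" "i - (m - s) \<le> r + s"
      using that s by linarith+
    ultimately show ?thesis
      using x(2)[of "i - (m - s)"] that s by simp
  qed
  have v_far: "v i = g (i + s)" if "1 \<le> i" "i \<le> r - s" for i
    using v(2)[OF that] g_far[OF that] s by (simp add: hi_def)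
  \<comment> \<open>The first \<open>r - s\<close> values of \<open>v\<close> all exceed
    \<open>g i\<close>, so the values \<open>1\<close> to \<open>g i\<close> open its tail.\<close>
  have v_near: "v (r - s + g i) = g i" if i: "1 \<le> i" "i \<le> s" for i
  proof (rule tail_increasing_initial[OF v(1)])
    show "g i < v k" if "1 \<le> k" "k \<le> r - s" for k
      unfolding v_far[OF that] using that i s by (intro strict_mono_onD[OF g(3)]) auto
    show "1 \<le> g i" "g i \<le> ?n"
      using tail_increasing_apply[OF g(1), of i] i s by auto
  qed (use s in auto)
  define y where "y = x \<circ> block_unswap m r s"
  have xinj: "i = k" if "x i = x k" "i \<in> {1..?n}" "k \<in> {1..?n}" for i k
    using x(1) that unfolding tail_increasing_def bij_betw_def by (meson inj_onD)
  have agree: "(v \<circ> y) i = g i" if "1 \<le> i" "i \<le> r" for i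
  proof (cases "i \<le> s")
    case True
    then have "block_unswap m r s i = r - s + i"
      using that by (simp add: block_unswap_def)
    then show ?thesis
      using x_near[of i] v_near[of i] that True by (simp add: y_def)
  next
    case False
    then have "block_unswap m r s i = i - s"
      using that by (simp add: block_unswap_def)
    then show ?thesis
      using x_far[of "i - s"] v_far[of "i - s"] that False by (simp add: y_def)
  qed
  \<comment> \<open>Injectivity of \<open>x\<close> gives both bounds: the values up to
    \<open>r - s\<close> are used by the fixed points, the top \<open>s\<close> values by the empty
    columns. So \<open>y\<close> maps \<open>r + 1..n\<close> into the increasing tail of
    \<open>v\<close>, with the middle block below the top block.\<close>
  have big: "r - s < x k" if "r < k" "k \<le> ?n" for k
  proof (rule ccontr)
    assume "\<not> r - s < x k"
    moreover have "1 \<le> x k"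
      using tail_increasing_apply[OF x(1), of k] that by auto
    ultimately have "x (x k) = x k" "x k \<le> r"
      using x_far[of "x k"] by auto
    then have "x k = k"
      using xinj[of "x k" k] \<open>1 \<le> x k\<close> that by simp
    then show False using \<open>x k \<le> r\<close> that by simp
  qed
  have small: "x k \<le> ?n - s" if "r + s < k" "k \<le> ?n" for k
  proof (rule ccontr)
    assume a: "\<not> x k \<le> ?n - s"
    have le: "x k \<le> ?n"
      using tail_increasing_apply[OF x(1), of k] that by auto
    then have "x (x k - (m - s)) = x k"
      using x_top[of "x k"] a by simp
    moreover have "x k - (m - s) \<in> {1..?n}" "k \<in> {1..?n}"
      using a le that s by auto
    ultimately have "x k - (m - s) = k"
      by (rule xinj)
    then show False using le that s by linarith
  qed
  have y_mid: "y i = x (i + s)" if "r < i" "i \<le> ?n - s" for i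
    using that s by (simp add: y_def block_unswap_def)
  have y_top: "y i = i" if "?n - s < i" "i \<le> ?n" for i
  proof -
    have "r < i" using that s by linarith
    then have "block_unswap m r s i = i - (m - s)"
      using that s by (simp add: block_unswap_def)
    then show ?thesis
      using x_top[OF that] by (simp add: y_def)
  qed
  have y_range: "y i \<in> {r - s<..?n}" if "i \<in> {r<..?n}" for i
  proof (cases "i \<le> ?n - s")
    case True
    then show ?thesis
      using that y_mid[of i] big[of "i + s"] tail_increasing_apply[OF x(1), of "i + s"] by auto
  next
    case False
    then show ?thesis
      using that y_top[of i] s by auto
  qed
  have y_mono: "y i < y k" if "i \<in> {r<..?n}" "k \<in> {r<..?n}" "i < k" for i k
  proof -
    consider "k \<le> ?n - s" | "i \<le> ?n - s" "?n - s < k" | "?n - s < i" by linarith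
    then show ?thesis
    proof cases
      case 1
      have "x (i + s) < x (k + s)"
        using x(1) that 1 by (intro strict_mono_onD[of "{r + s<..?n}" x]) (auto simp: tail_increasing_def)
      then show ?thesis
        using y_mid[of i] y_mid[of k] that 1 by simp
    next
      case 2
      have "x (i + s) \<le> ?n - s"
        using that 2 by (intro small) auto
      then show ?thesis
        using y_mid[of i] y_top[of k] that 2 by simp
    next
      case 3
      then show ?thesis
        using y_top[of i] y_top[of k] that by simp
    qed
  qed
  have "bij_betw (v \<circ> y) {1..?n} {1..?n}"
    unfolding y_def using v(1) x(1) bij_betw_block_unswap[OF s]
    by (intro bij_betw_trans[of _ _ "{1..?n}"]) (auto simp: tail_increasing_def)
  moreover have "strict_mono_on {r<..?n} (v \<circ> y)"
  proof (rule strict_mono_onI)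
    fix i k assume ik: "i \<in> {r<..?n}" "k \<in> {r<..?n}" "i < k"
    have "strict_mono_on {r - s<..?n} v"
      using v(1) by (simp add: tail_increasing_def)
    then show "(v \<circ> y) i < (v \<circ> y) k"
      using strict_mono_onD y_range[OF ik(1)] y_range[OF ik(2)] y_mono[OF ik] by fastforce
  qed
  moreover have "(v \<circ> y) i = i" if "i \<notin> {1..?n}" for i
  proof -
    have "block_unswap m r s i = i"
      using that s by (auto simp: block_unswap_def)
    then show ?thesis
      using v(1) x(1) that by (simp add: y_def tail_increasing_def)
  qed
  ultimately have "tail_increasing ?n r (v \<circ> y)"
    by (simp add: tail_increasing_def)
  then have "v \<circ> y = g"
    using g(1) agree by (intro tail_increasing_eqI[of ?n r]) auto
  then have "g \<circ> block_swap m r s = v \<circ> x"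
    using block_unswap_swap(1)[OF s] unfolding y_def fun_eq_iff comp_apply by metis
  then show ?thesis
    unfolding eta1 eta2 x_def v_def g_def by simp
qed

section \<open>Degree vectors and the domain of \<open>Phi_Fl\<close>\<close>

lemma rev_deg_vec: "rev (deg_vec a b e) = deg_vec b a e"
  by (simp add: deg_vec_def add.commute)

text \<open>By \<open>diag_gap\<close> the last \<open>s\<close> columns have height at most
  \<open>m - s\<close>, so the upper part has at most \<open>r - s\<close> columns; the bound
  \<open>2 * m\<close> leaves it at most \<open>m + s\<close> rows.\<close>

lemma Phi_Fl_eq_Some:
  assumes c: "cyclic_columns m r c" and gap: "diag_gap m r c s" and top: "c 1 \<le> 2 * m" and "s \<le> m"
    and "lam \<subseteq> rect (m + r) r" and "mu \<subseteq> rect (m + r) r" and eta: "\<eta> = shape_of r c"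
  shows "Phi_Fl m r (K_LR k lam mu \<eta>) =
    Some (Fl_LR (varphi (m + r) r lam) (varphi (m + r) r mu)
      (varphi (m + r) (r - s) (upper_rows (m - s) \<eta>) \<circ> varphi (m + r) (r + s) (bottom_rows (m - s) \<eta>))
      (deg_vec r m s))"
proof -
  have mono: "c j \<le> c i" if "1 \<le> i" "i \<le> j" "j \<le> r" for i j
    using c that by (auto simp: cyclic_columns_def intro: antimono_on_intervalD)
  have s: "s \<le> r"
    using gap by (simp add: diag_gap_def)
  have d: "diag0 (compl_inside (m + r) r \<eta>) = s"
    unfolding eta using c gap by (intro diag0_compl_inside) (simp add: cyclic_columns_def)
  have "bottom_rows (m - s) \<eta> \<subseteq> rect (m + r) (r + s)"
    by (auto simp: eta bottom_rows_def rect_def)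
  moreover have "upper_rows (m - s) \<eta> \<subseteq> rect (m + r) (r - s)"
  proof
    fix z assume "z \<in> upper_rows (m - s) \<eta>"
    then obtain i j where z: "z = (i, j)" "1 \<le> i" "1 \<le> j" "j \<le> r" "i + (m - s) \<le> c j"
      by (auto simp: eta upper_rows_def)
    have "c j \<le> c 1"
      using z by (intro mono) auto
    then have "i \<le> m + s"
      using top z \<open>s \<le> m\<close> by linarith
    moreover have "j \<le> r - s"
    proof (rule ccontr)
      assume "\<not> j \<le> r - s"
      then have "c j \<le> c (r + 1 - s)" "0 < s"
        using z s by (auto intro!: mono)
      moreover from this have "c (r + 1 - s) + s \<le> m"
        using gap by (simp add: diag_gap_def)
      ultimately show False
        using z by linarith
    qed
    ultimately show "z \<in> rect (m + r) (r - s)"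
      using z s by (simp add: rect_def)
  qed
  ultimately show ?thesis
    using assms(5,6) by (simp add: d Let_def)
qed

text \<open>Here \<open>s = 0\<close>, and the first column of the upper part sticks out of its
  rectangle.\<close>

lemma Phi_Fl_eq_None:
  assumes c: "cyclic_columns m r c" and gap: "diag_gap m r c 0" and top: "2 * m < c 1" and "1 \<le> r"
  shows "Phi_Fl m r (K_LR k lam mu (shape_of r c)) = None"
proof -
  have d: "diag0 (compl_inside (m + r) r (shape_of r c)) = 0"
    using c gap by (intro diag0_compl_inside) (simp add: cyclic_columns_def)
  have "(m + 1, 1) \<in> upper_rows m (shape_of r c)"
    using top \<open>1 \<le> r\<close> by (simp add: upper_rows_def)
  moreover have "(m + 1, 1) \<notin> rect (m + r) r"
    by (simp add: rect_def)
  ultimately have "\<not> upper_rows m (shape_of r c) \<subseteq> rect (m + r) r"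
    by blast
  then show ?thesis
    by (simp add: d Let_def)
qed

section \<open>Commutativity of the diagram\<close>

theorem mainTheorem1:
  fixes m r n k d s :: nat and t :: int
    and lam mu nu \<eta> \<eta>1 \<eta>2 :: shape
    and c :: gr_lr
  assumes "m + r = n" and "1 \<le> n" and "k = n - 1"
    and "is_partition lam" and "lam \<subseteq> rect n r"
    and "is_partition mu" and "mu \<subseteq> rect n r"
    and "is_partition nu" and "nu \<subseteq> rect n r"
    and "card lam + card mu = card nu + n * d"
    and "c = Gr_LR lam mu nu (int d)"
    and "t = int (diag0 (compl_in n r nu)) - int d"
    and "\<eta> = oplus n r nu d"
    and "s = diag0 (compl_inside n r \<eta>)"
    and "\<eta>1 = bottom_rows (m - s) \<eta>"
    and "\<eta>2 = upper_rows (m - s) \<eta>"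
  shows "(Gamma_T n \<circ>\<^sub>m Psi_PC m r \<circ>\<^sub>m Gamma_SD m r) c = (Phi_Fl m r \<circ>\<^sub>m Phi_Gr m r) c
    \<and> (add_rim_hook n r ^^ d) nu \<eta>
    \<and> Phi_Gr m r c = Some (K_LR k lam mu \<eta>)
    \<and> (0 \<le> t \<longrightarrow>
        (Gamma_T n \<circ>\<^sub>m Psi_PC m r \<circ>\<^sub>m Gamma_SD m r) c =
          Some (Fl_LR (w0 n \<circ> w_perm n m (compl_in n r lam) \<circ> w0 n)
            (w0 n \<circ> w_perm n m (compl_in n r mu) \<circ> w0 n)
            (w0 n \<circ> w_perm n m (compl_in n r (phi_rot m r r nu)) \<circ> w0P m n \<circ> w0P' m n (nat t) \<circ> w0 n)
            (deg_vec r m (nat t)))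
        \<and> (Phi_Fl m r \<circ>\<^sub>m Phi_Gr m r) c =
          Some (Fl_LR (varphi n r lam) (varphi n r mu)
            (varphi n (r - s) \<eta>2 \<circ> varphi n (r + s) \<eta>1) (deg_vec r m s))
        \<and> w0 n \<circ> w_perm n m (compl_in n r lam) \<circ> w0 n = varphi n r lam
        \<and> w0 n \<circ> w_perm n m (compl_in n r mu) \<circ> w0 n = varphi n r mu
        \<and> w0 n \<circ> w_perm n m (compl_in n r (phi_rot m r r nu)) \<circ> w0P m n \<circ> w0P' m n (nat t) \<circ> w0 n
            = varphi n (r - s) \<eta>2 \<circ> varphi n (r + s) \<eta>1
        \<and> deg_vec r m (nat t) = deg_vec r m s)"
proof -
  define c0 where "c0 = col nu"
  define ce where "ce = (add_hook m r ^^ d) c0"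
  define D where "D = diag0 (compl_in n r nu)"
  have n: "n = m + r" using assms(1) by simp
  have lam: "is_partition lam" "lam \<subseteq> rect (m + r) r" and mu: "is_partition mu" "mu \<subseteq> rect (m + r) r"
    and nu: "is_partition nu" "nu \<subseteq> rect (m + r) r"
    using assms(4-9) n by simp_all
  have rd: "1 \<le> r \<or> d = 0"
  proof (cases "r = 0")
    case True
    then have "lam = {}" "mu = {}"
      using lam(2) mu(2) by (auto simp: rect_def)
    then show ?thesis
      using assms(2,10) by simp
  qed simp
  have bound: "c0 j \<le> m" for j
    unfolding c0_def by (rule col_le_of_subset_rect[OF nu(2)])
  have c0: "cyclic_columns m r c0"
    unfolding cyclic_columns_def using antimono_col[OF nu(1)] bound[of 1] by (simp add: c0_def)
  have nu_eq: "shape_of r c0 = nu"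
    unfolding c0_def by (rule shape_of_col_rect[OF nu])
  obtain D' where D': "diag_gap m r c0 D'"
    using diag_gap_exists by blast
  have "compl_inside n r nu = compl_in n r nu"
    using assms(9) by (simp add: compl_inside_def Int_absorb2)
  then have "D = D'"
    unfolding D_def n using diag0_compl_inside[OF _ D'] c0 nu_eq by (simp add: cyclic_columns_def)
  then have gap0: "diag_gap m r c0 D" using D' by simp
  have ce: "cyclic_columns m r ce" and gap: "diag_gap m r ce (D - d)"
    unfolding ce_def using cyclic_columns_funpow[OF c0 rd] diag_gap_funpow[OF c0 gap0 rd] by simp_all
  have iff: "(add_rim_hook n r ^^ d) nu T \<longleftrightarrow> T = shape_of r ce" for T
    using add_rim_hook_relpowp_iff[OF c0 rd, of T] by (simp add: nu_eq n ce_def)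
  have eta: "\<eta> = shape_of r ce"
    unfolding assms(13) oplus_def iff by simp
  have s: "s = D - d"
    unfolding assms(14) eta n using ce gap by (intro diag0_compl_inside) (simp add: cyclic_columns_def)
  have t: "t = int D - int d"
    using assms(12) by (simp add: D_def)
  have Phi_Gr: "Phi_Gr m r c = Some (K_LR k lam mu \<eta>)"
    using assms(3,11,13) n by simp
  have SD: "Gamma_SD m r c = Some (Gr_LR (compl_in n r lam) (compl_in n r mu)
      (compl_in n r (phi_rot m r r nu)) t)"
    using assms(11,12) n by simp
  have u: "w0 n \<circ> w_perm n m (compl_in n r S) \<circ> w0 n = varphi n r S"
    if "is_partition S" "S \<subseteq> rect (m + r) r" for S
    unfolding n by (rule w0_conj_compl[OF that])
  show ?thesis
  proof (cases "d \<le> D")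
    case True
    then have nat_t: "nat t = s" and t0: "0 \<le> t" "t = int s"
      using t s by auto
    have gap_s: "diag_gap m r ce s" using gap s by simp
    have sr: "s \<le> r"
      using gap_s by (simp add: diag_gap_def)
    have sm: "s \<le> m"
      using gap_s by (cases "s = 0") (auto simp: diag_gap_def)
    have "c0 1 \<le> 2 * m" using bound[of 1] by simp
    then have top: "ce 1 \<le> 2 * m"
      unfolding ce_def using True by (intro height_funpow_le[OF c0 gap0 rd]) auto
    have res: "residues m r ce = residues m r (col nu)"
      unfolding ce_def c0_def by (rule residues_funpow[OF rd])
    have rot: "phi_rot m r r nu = shape_of r (rotated_columns m r s ce)"
      by (rule phi_rot_columns[OF nu ce gap_s top res])
    note e = rotated_columns_bounds[OF ce gap_s top]
    have rho: "is_partition (phi_rot m r r nu)" "phi_rot m r r nu \<subseteq> rect (m + r) r"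
      unfolding rot using is_partition_shape_of[OF e(1)] shape_of_rect[OF e(2)] by simp_all
    \<comment> \<open>Inserting this square splits the product into a conjugate, handled by
      \<open>u\<close>, and the block exchange.\<close>
    have w0w0: "w0 n \<circ> w0 n = id"
      by (auto simp: w0_apply fun_eq_iff)
    let ?u = "w_perm n m (compl_in n r (phi_rot m r r nu))"
    have "w0 n \<circ> ?u \<circ> w0P m n \<circ> w0P' m n s \<circ> w0 n =
        (w0 n \<circ> ?u \<circ> w0 n) \<circ> (w0 n \<circ> w0P m n \<circ> w0P' m n s \<circ> w0 n)"
      using w0w0 by (simp add: fun_eq_iff)
    also have "\<dots> = varphi n r (phi_rot m r r nu) \<circ> block_swap m r s"
      unfolding u[OF rho] using block_swap_eq[OF sm sr] n by simp
    also have "\<dots> = varphi n (r - s) \<eta>2 \<circ> varphi n (r + s) \<eta>1"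
      unfolding assms(15,16) rot eta n using composite_eq[OF ce gap_s top sm sr] by simp
    finally have w: "w0 n \<circ> ?u \<circ> w0P m n \<circ> w0P' m n s \<circ> w0 n =
        varphi n (r - s) \<eta>2 \<circ> varphi n (r + s) \<eta>1" .
    have left: "(Gamma_T n \<circ>\<^sub>m Psi_PC m r \<circ>\<^sub>m Gamma_SD m r) c =
        Some (Fl_LR (w0 n \<circ> w_perm n m (compl_in n r lam) \<circ> w0 n)
          (w0 n \<circ> w_perm n m (compl_in n r mu) \<circ> w0 n)
          (w0 n \<circ> ?u \<circ> w0P m n \<circ> w0P' m n s \<circ> w0 n) (deg_vec r m s))"
      using SD t0 sr sm by (simp add: map_comp_def n rev_deg_vec comp_assoc)
    have right: "(Phi_Fl m r \<circ>\<^sub>m Phi_Gr m r) c =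
        Some (Fl_LR (varphi n r lam) (varphi n r mu)
          (varphi n (r - s) \<eta>2 \<circ> varphi n (r + s) \<eta>1) (deg_vec r m s))"
      using Phi_Gr Phi_Fl_eq_Some[OF ce gap_s top sm lam(2) mu(2) eta, of k]
      by (simp add: map_comp_def n assms(15,16) del: Phi_Fl.simps Phi_Gr.simps)
    show ?thesis
      using left right Phi_Gr iff[of \<eta>] eta u[OF lam] u[OF mu] w unfolding nat_t by simp
  next
    \<comment> \<open>With more than \<open>D\<close> hooks the degree after strange duality is
      negative and the shape is too high for \<open>Phi_Fl\<close>, so both composites are
      undefined.\<close>
    case False
    then have "1 \<le> r" and neg: "t < 0" and s0: "diag_gap m r ce 0"
      using rd t gap by auto
    then have "Phi_Fl m r (K_LR k lam mu \<eta>) = None"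
      unfolding eta ce_def using False ce s0
      by (intro Phi_Fl_eq_None height_funpow_gt[OF c0 gap0]) (auto simp: ce_def)
    then have "(Phi_Fl m r \<circ>\<^sub>m Phi_Gr m r) c = None"
      using Phi_Gr by (simp add: map_comp_def del: Phi_Fl.simps Phi_Gr.simps)
    moreover have "(Gamma_T n \<circ>\<^sub>m Psi_PC m r \<circ>\<^sub>m Gamma_SD m r) c = None"
      using SD neg by (simp add: map_comp_def)
    ultimately show ?thesis
      using Phi_Gr iff[of \<eta>] eta neg by simp
  qed
qed

end
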